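(* Let $\tau>0$, $\gamma\in\mathbb R$, $x\in\mathbb R$ and $z\in\mathbb C$ with $0<|z|<1$. Let $\mathbf T_\gamma:L^2(0,\infty)\to L^2(0,\infty)$ be the integral operator with kernel $$\mathbf T_\gamma(s,t)=\mathcal T_\gamma(s+x+t),\qquad \mathcal T_\gamma(s)=\sum_{\xi\in\mathcal S_-(z)}\frac{e^{-\frac{\tau}{3}\xi^3+\frac{\gamma}{2}\xi^2+s\xi-Q(\xi)}}{-\xi},\qquad s,t>0,$$ and let $\mathbf T_{-\gamma}$ be the operator obtained by replacing $\gamma$ with $-\gamma$. Then $\mathbf T_{\gamma}$ is trace class, and $$\det(\mathbf I-\mathbf K_z)_{\ell^2(\mathcal S_-(z))}=\det(\mathbf I-\mathbf T_{-\gamma}\mathbf T_{\gamma})_{L^2(0,\infty)} .$$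
   Context: Roots and logarithms are principal branches. $\mathrm{Li}_s$ is the polylogarithm, $\mathrm{Li}_s(z)=\sum_{k\ge1}z^k/k^s$ for $|z|<1$, continued analytically to $\mathbb C\setminus[1,\infty)$. For $0<|z|<1$, $\mathcal S_-=\mathcal S_-(z)=\{\xi\in\mathbb C: e^{-\xi^2/2}=z,\ \mathrm{Re}\,\xi<0\}$; this discrete set lies in the sector $3\pi/4<\arg\xi<5\pi/4$. In that sector $$Q(\xi)=\sqrt{\tfrac2\pi}\int_{-\infty}^{\xi}\mathrm{Li}_{1/2}(e^{-s^2/2})\,ds$$ (path inside the sector), and $\Phi(\xi)=-\frac13\tau\xi^3+x\xi-Q(\xi)$. The operator $\mathbf K_z$ is the trace class operator on $\ell^2(\mathcal S_-)$ with kernel $$\mathbf K_z(\xi_1,\xi_2)=\sum_{\eta\in\mathcal S_-}\frac{e^{\frac12\Phi(\xi_1)+\Phi(\eta)+\frac12\Phi(\xi_2)+\frac\gamma4(\xi_1^2-2\eta^2+\xi_2^2)}}{\sqrt{-\xi_1}\,(-\eta)\,(\xi_1+\eta)(\eta+\xi_2)\sqrt{-\xi_2}} ,$$ which is conjugate (same Fredholm determinant) to $\sum_{\eta\in\mathcal S_-}\frac{e^{\Phi(\xi_1)+\Phi(\eta)+\frac\gamma2(\xi_1^2-\eta^2)}}{\xi_1\eta(\xi_1+\eta)(\eta+\xi_2)}$. *)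

theory Defs
  imports "HOL-Analysis.Analysis" "Jordan_Normal_Form.Determinant"
begin

section \<open>Operators on complex L2 spaces\<close>

text \<open>
  Elements of the Hilbert space are represented by functions, and operators by maps on functions;
  all identities between functions are understood almost everywhere.  For the counting measure on
  a set S this is the sequence space over S.
\<close>

definition L2_fun :: "'a measure \<Rightarrow> ('a \<Rightarrow> complex) set" where
  "L2_fun M = {f \<in> borel_measurable M. integrable M (\<lambda>x. (cmod (f x))\<^sup>2)}"

definition L2_nrm :: "'a measure \<Rightarrow> ('a \<Rightarrow> complex) \<Rightarrow> real" where
  "L2_nrm M f = sqrt (LINT x|M. (cmod (f x))\<^sup>2)"

text \<open>
  Linearity and boundedness together imply that such a map respects equality almost everywhere.
\<close>

definition bounded_L2_op :: "'a measure \<Rightarrow> (('a \<Rightarrow> complex) \<Rightarrow> ('a \<Rightarrow> complex)) \<Rightarrow> bool" where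
  "bounded_L2_op M A \<longleftrightarrow>
     (\<forall>f \<in> L2_fun M. A f \<in> L2_fun M) \<and>
     (\<forall>f \<in> L2_fun M. \<forall>g \<in> L2_fun M. AE x in M. A (\<lambda>y. f y + g y) x = A f x + A g x) \<and>
     (\<forall>c. \<forall>f \<in> L2_fun M. AE x in M. A (\<lambda>y. c * f y) x = c * A f x) \<and>
     (\<exists>C. \<forall>f \<in> L2_fun M. L2_nrm M (A f) \<le> C * L2_nrm M f)"

definition rank_at_most :: "'a measure \<Rightarrow> nat \<Rightarrow> (('a \<Rightarrow> complex) \<Rightarrow> ('a \<Rightarrow> complex)) \<Rightarrow> bool" where
  "rank_at_most M n A \<longleftrightarrow>
     (\<exists>h :: nat \<Rightarrow> 'a \<Rightarrow> complex. (\<forall>i<n. h i \<in> L2_fun M) \<and>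
        (\<forall>f \<in> L2_fun M. \<exists>c :: nat \<Rightarrow> complex. AE x in M. A f x = (\<Sum>i<n. c i * h i x)))"

text \<open>
  The singular value with index n is the distance, in operator norm, from the bounded operators
  of rank at most n (so the index starts at 0, where it is the operator norm).  For bounded A the
  set below is nonempty, since the zero operator has rank at most n.
\<close>

definition singular_value :: "'a measure \<Rightarrow> (('a \<Rightarrow> complex) \<Rightarrow> ('a \<Rightarrow> complex)) \<Rightarrow> nat \<Rightarrow> real" where
  "singular_value M A n =
     Inf {C. 0 \<le> C \<and> (\<exists>F. bounded_L2_op M F \<and> rank_at_most M n F \<and>
            (\<forall>f \<in> L2_fun M. L2_nrm M (\<lambda>x. A f x - F f x) \<le> C * L2_nrm M f))}"

definition trace_class :: "'a measure \<Rightarrow> (('a \<Rightarrow> complex) \<Rightarrow> ('a \<Rightarrow> complex)) \<Rightarrow> bool" where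
  "trace_class M A \<longleftrightarrow> bounded_L2_op M A \<and> summable (singular_value M A)"

definition kernel_op :: "'a measure \<Rightarrow> ('a \<Rightarrow> 'a \<Rightarrow> complex) \<Rightarrow> ('a \<Rightarrow> complex) \<Rightarrow> ('a \<Rightarrow> complex)" where
  "kernel_op M K f = (\<lambda>x. LINT y|M. K x y * f y)"

text \<open>
  The first conjunct excludes kernels whose integral would only be defined through the convention
  that the integral of a non-integrable function is 0.
\<close>

definition trace_class_kernel :: "'a measure \<Rightarrow> ('a \<Rightarrow> 'a \<Rightarrow> complex) \<Rightarrow> bool" where
  "trace_class_kernel M K \<longleftrightarrow>
     (\<forall>f \<in> L2_fun M. AE x in M. integrable M (\<lambda>y. K x y * f y)) \<and>
     trace_class M (kernel_op M K)"

text \<open>The kernel of the product of two integral operators.\<close>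

definition kernel_comp ::
  "'a measure \<Rightarrow> ('a \<Rightarrow> 'a \<Rightarrow> complex) \<Rightarrow> ('a \<Rightarrow> 'a \<Rightarrow> complex) \<Rightarrow> 'a \<Rightarrow> 'a \<Rightarrow> complex" where
  "kernel_comp M K L = (\<lambda>x y. LINT u|M. K x u * L u y)"

text \<open>
  The Fredholm determinant of I - K on the L2 space of M has the value D, by Fredholm's expansion
  \[ \sum_{n \ge 0} \frac{(-1)^n}{n!} \int_{M^n} \det [K(x_i,x_j)]_{i,j<n} \, dx , \]
  where all integrals and the series are required to converge.  For the counting measure on S
  the integrals are sums over n-tuples from S.
\<close>

definition has_fredholm_det :: "'a measure \<Rightarrow> ('a \<Rightarrow> 'a \<Rightarrow> complex) \<Rightarrow> complex \<Rightarrow> bool" where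
  "has_fredholm_det M K D \<longleftrightarrow>
     (\<forall>n. integrable (PiM {..<n} (\<lambda>_. M)) (\<lambda>x. Determinant.det (mat n n (\<lambda>(i, j). K (x i) (x j))))) \<and>
     (\<lambda>n. (-1) ^ n / fact n *
        (LINT x|PiM {..<n} (\<lambda>_. M). Determinant.det (mat n n (\<lambda>(i, j). K (x i) (x j))))) sums D"

definition half_line :: "real measure" where
  "half_line = restrict_space lborel {0<..}"


section \<open>The functions and kernels\<close>

text \<open>
  Only the power series on the open unit disc is needed: the polylogarithm is evaluated below at
  exp (- s^2 / 2) with s in the sector 3 pi / 4 < arg s < 5 pi / 4, where Re (s^2) > 0.
\<close>

definition polylog :: "complex \<Rightarrow> complex \<Rightarrow> complex" where
  "polylog s w = (\<Sum>k. w ^ Suc k / of_nat (Suc k) powr s)"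

definition S_minus :: "complex \<Rightarrow> complex set" where
  "S_minus z = {\<xi>. exp (- \<xi>\<^sup>2 / 2) = z \<and> Re \<xi> < 0}"

text \<open>
  The path from minus infinity to \<open>\<xi>\<close> is the horizontal ray \<open>s = \<xi> + t\<close>, \<open>t \<le> 0\<close>, which stays in the
  sector 3 pi / 4 < arg < 5 pi / 4 whenever \<open>\<xi>\<close> lies in it.
\<close>

definition Q_fun :: "complex \<Rightarrow> complex" where
  "Q_fun \<xi> = complex_of_real (sqrt (2 / pi)) *
     (LINT t:{..0::real}|lborel. polylog (1 / 2) (exp (- (\<xi> + complex_of_real t)\<^sup>2 / 2)))"

definition Phi :: "real \<Rightarrow> real \<Rightarrow> complex \<Rightarrow> complex" where
  "Phi \<tau> x \<xi> = - (complex_of_real \<tau> / 3) * \<xi> ^ 3 + complex_of_real x * \<xi> - Q_fun \<xi>"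

definition K_ker :: "real \<Rightarrow> real \<Rightarrow> real \<Rightarrow> complex \<Rightarrow> complex \<Rightarrow> complex \<Rightarrow> complex" where
  "K_ker \<tau> \<gamma> x z \<xi>\<^sub>1 \<xi>\<^sub>2 =
     (\<Sum>\<^sub>\<infinity>\<eta>\<in>S_minus z.
        exp (Phi \<tau> x \<xi>\<^sub>1 / 2 + Phi \<tau> x \<eta> + Phi \<tau> x \<xi>\<^sub>2 / 2
             + complex_of_real \<gamma> / 4 * (\<xi>\<^sub>1\<^sup>2 - 2 * \<eta>\<^sup>2 + \<xi>\<^sub>2\<^sup>2))
        / (csqrt (- \<xi>\<^sub>1) * (- \<eta>) * (\<xi>\<^sub>1 + \<eta>) * (\<eta> + \<xi>\<^sub>2) * csqrt (- \<xi>\<^sub>2)))"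

definition T_fun :: "real \<Rightarrow> real \<Rightarrow> complex \<Rightarrow> real \<Rightarrow> complex" where
  "T_fun \<tau> \<gamma> z s =
     (\<Sum>\<^sub>\<infinity>\<xi>\<in>S_minus z.
        exp (- (complex_of_real \<tau> / 3) * \<xi> ^ 3 + complex_of_real \<gamma> / 2 * \<xi>\<^sup>2
             + complex_of_real s * \<xi> - Q_fun \<xi>) / (- \<xi>))"

definition T_ker :: "real \<Rightarrow> real \<Rightarrow> real \<Rightarrow> complex \<Rightarrow> real \<Rightarrow> real \<Rightarrow> complex" where
  "T_ker \<tau> \<gamma> x z s t = T_fun \<tau> \<gamma> z (s + x + t)"

end

theory Submission
  imports Defs
begin

text \<open>
  Both kernels are the two products of one pair A, B, since the integral of exp(t w) over the half
  line is -1/w.  With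
  p(\<xi>)^2 and v(\<eta>) the coefficients of the exponential sums for \<open>\<gamma>\<close> and \<open>-\<gamma>\<close>, put
  B(\<xi>, t) = p(\<xi>) exp(t \<xi>) and A(s, \<xi>) = p(\<xi>) \<Sum>\<eta>. v(\<eta>) exp(s \<eta>) / (-(\<eta> + \<xi>)).  Then BA is K
  on the discrete set, AB is the product of the two operators on the half line, and det (I - BA) =
  det (I - AB).  Convergence rests on the decay of exp(-\<tau> \<xi>^3 / 3) along the set, which beats any
  geometric sequence in the index of the point; Q is merely bounded there.
\<close>

section \<open>Fredholm determinants\<close>

text \<open>Let B^t be B with its arguments exchanged. Since exp((s + t) \<xi>) = exp(s \<xi>) exp(t
  \<xi>), the operator for \<gamma> factors as B^t B through the discrete set. Hence the product of
  the two operators is AB with A = (operator for -\<gamma>) B^t, and the formula for A is this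
  composition evaluated. Only p^2 enters on the half line; the choice of root is visible in K alone.

  The estimates come from one geometric fact: taking moduli in exp(-\<xi>^2/2) = z puts the set on a
  branch of the hyperbola Re(\<xi>^2) = -2 ln |z|. Its vertex keeps the real parts below a negative
  constant, so the denominators \<xi> + \<eta> stay away from 0 and the exponentials are integrable.
  The factor with \<gamma> has constant modulus there, so the same argument covers \<gamma> and
  -\<gamma>. Finally Re(\<xi>^3) grows like |Re \<xi>|^3 along the branch.

  Convergence of the Fredholm series is proved on the discrete side, where tuples can be counted;
  the half line inherits convergence and sum, because the n-th terms agree.\<close>

lemma det_mat_Leibniz:
  "Determinant.det (mat n n f) =
     (\<Sum>p | p permutes {..<n}. signof p * (\<Prod>i<n. f (i, p i)))"
proof -
  have "(\<Prod>i = 0..<n. mat n n f $$ (i, p i)) = (\<Prod>i<n. f (i, p i))" if "p permutes {..<n}" for p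
    unfolding atLeast0LessThan
    by (intro prod.cong refl) (use permutes_in_image[OF that] in auto)
  then show ?thesis
    by (simp add: det_def'[of _ n] atLeast0LessThan)
qed

lemma det_mat_transpose:
  "Determinant.det (mat n n (\<lambda>(i, j). f j i)) = Determinant.det (mat n n (\<lambda>(i, j). f i j))"
proof -
  have "mat n n (\<lambda>(i, j). f j i) = transpose_mat (mat n n (\<lambda>(i, j). f i j))"
    by (intro eq_matI) auto
  then show ?thesis
    by (simp add: det_transpose[of _ n])
qed

lemma norm_signof_le: "cmod (signof p) \<le> 1"
  by (cases p rule: sign_cases) auto

text \<open>The crude bound by n! Leibniz terms. The premise concerns products along permutations,
  not entries: when entries are dominated by a row factor times a column factor, all these products
  have one common bound.\<close>

lemma cmod_det_mat_le:
  fixes f :: "nat \<times> nat \<Rightarrow> complex"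
  assumes "\<And>p. p permutes {..<n} \<Longrightarrow> (\<Prod>i<n. cmod (f (i, p i))) \<le> b"
  shows "cmod (Determinant.det (mat n n f)) \<le> fact n * b"
proof -
  have "cmod (Determinant.det (mat n n f)) \<le>
    (\<Sum>p | p permutes {..<n}. cmod (signof p * (\<Prod>i<n. f (i, p i))))"
    unfolding det_mat_Leibniz by (rule norm_sum)
  also have "\<dots> \<le> (\<Sum>p | p permutes {..<n}. b)"
  proof (intro sum_mono)
    fix p assume p: "p \<in> {p. p permutes {..<n}}"
    have "cmod (signof p * (\<Prod>i<n. f (i, p i))) \<le> 1 * (\<Prod>i<n. cmod (f (i, p i)))"
      unfolding norm_mult prod_norm[symmetric]
      by (intro mult_right_mono norm_signof_le prod_nonneg) auto
    then show "cmod (signof p * (\<Prod>i<n. f (i, p i))) \<le> b"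
      using assms[of p] p by auto
  qed
  also have "\<dots> = fact n * b"
    by (simp add: card_permutations[of "{..<n}" n])
  finally show ?thesis .
qed

lemma det_mat_eq_0_if_not_inj:
  assumes "\<not> inj_on y {..<n}"
  shows "Determinant.det (mat n n (\<lambda>(i, j). f (y i) (y j))) = 0"
proof -
  obtain i j where "i < n" "j < n" "i \<noteq> j" "y i = y j"
    using assms by (auto simp: inj_on_def)
  then show ?thesis
    by (intro det_identical_rows[of _ n i j] eq_vecI) auto
qed

text \<open>Row i has its own integration variable \<open>y i\<close>. A Leibniz term takes one
  factor from each row, so it is a product of functions of distinct variables and its integral
  factorizes.\<close>

lemma det_mat_lebesgue_integral:
  fixes F :: "nat \<Rightarrow> nat \<Rightarrow> 'b \<Rightarrow> complex"
  assumes "sigma_finite_measure N"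
    and int: "\<And>i j. i < n \<Longrightarrow> j < n \<Longrightarrow> integrable N (F i j)"
  shows "Determinant.det (mat n n (\<lambda>(i, j). LINT y|N. F i j y)) =
    (LINT y|PiM {..<n} (\<lambda>_. N). Determinant.det (mat n n (\<lambda>(i, j). F i j (y i))))"
proof -
  interpret sigma_finite_measure N by fact
  interpret product_sigma_finite "\<lambda>_. N" by standard
  have int': "i < n \<Longrightarrow> integrable N (F i (p i))" if "p permutes {..<n}" for i p
    using int[of i "p i"] permutes_in_image[OF that, of i] by auto
  have "(LINT y|PiM {..<n} (\<lambda>_. N). Determinant.det (mat n n (\<lambda>(i, j). F i j (y i)))) =
    (\<Sum>p | p permutes {..<n}. LINT y|PiM {..<n} (\<lambda>_. N). signof p * (\<Prod>i<n. F i (p i) (y i)))"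
    unfolding det_mat_Leibniz prod.case
    by (intro Bochner_Integration.integral_sum integrable_mult_right product_integrable_prod int') auto
  also have "\<dots> = (\<Sum>p | p permutes {..<n}. signof p * (\<Prod>i<n. LINT y|N. F i (p i) y))"
  proof (intro sum.cong refl)
    fix p assume "p \<in> {p. p permutes {..<n}}"
    then have "(LINT y|PiM {..<n} (\<lambda>_. N). (\<Prod>i<n. F i (p i) (y i))) = (\<Prod>i<n. LINT y|N. F i (p i) y)"
      by (intro product_integral_prod int') auto
    then show "(LINT y|PiM {..<n} (\<lambda>_. N). signof p * (\<Prod>i<n. F i (p i) (y i))) =
        signof p * (\<Prod>i<n. LINT y|N. F i (p i) y)"
      by simp
  qed
  finally show ?thesis
    by (simp add: det_mat_Leibniz)
qed

lemma borel_measurable_det_mat: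
  fixes F :: "nat \<Rightarrow> nat \<Rightarrow> 'b \<Rightarrow> complex"
  assumes "\<And>i j. i < n \<Longrightarrow> j < n \<Longrightarrow> F i j \<in> borel_measurable N"
  shows "(\<lambda>y. Determinant.det (mat n n (\<lambda>(i, j). F i j y))) \<in> borel_measurable N"
  unfolding det_mat_Leibniz prod.case
proof (intro borel_measurable_sum borel_measurable_times borel_measurable_prod)
  fix p i assume "p \<in> {p. p permutes {..<n}}" "i \<in> {..<n}"
  then show "F i (p i) \<in> borel_measurable N"
    using assms[of i "p i"] permutes_in_image[of p "{..<n}" i] by auto
qed auto

section \<open>Fubini's theorem and the commutation of BA and AB\<close>

lemma integrable_pair_mult:
  fixes f :: "'a \<Rightarrow> real" and g :: "'b \<Rightarrow> real"
  assumes "sigma_finite_measure M" "sigma_finite_measure N"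
    and f[measurable]: "integrable M f" and g[measurable]: "integrable N g"
  shows "integrable (M \<Otimes>\<^sub>M N) (\<lambda>(s, y). f s * g y)"
proof -
  interpret sigma_finite_measure M by fact
  interpret N: sigma_finite_measure N by fact
  interpret pair_sigma_finite M N ..
  show ?thesis
  proof (rule Fubini_integrable)
    show "integrable M (\<lambda>x. LINT y|N. norm (case (x, y) of (s, y) \<Rightarrow> f s * g y))"
      using integrable_norm[OF f] by (simp add: abs_mult)
    show "AE x in M. integrable N (\<lambda>y. case (x, y) of (s, y) \<Rightarrow> f s * g y)"
      using g by simp
  qed measurable
qed

text \<open>The form of Fubini's theorem used below, for n-tuples as well as for single sums: a
  dominating product of one-variable functions can be checked pointwise and gives joint
  integrability at once.\<close>

lemma integral_swap_of_bound:
  fixes F :: "'a \<Rightarrow> 'b \<Rightarrow> complex"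
  assumes "sigma_finite_measure M" "sigma_finite_measure N"
    and F: "case_prod F \<in> borel_measurable (M \<Otimes>\<^sub>M N)"
    and f: "integrable M f" and g: "integrable N g"
    and le: "\<And>s y. s \<in> space M \<Longrightarrow> y \<in> space N \<Longrightarrow> cmod (F s y) \<le> f s * g y"
  shows "integrable M (\<lambda>s. LINT y|N. F s y)"
    and "(LINT s|M. LINT y|N. F s y) = (LINT y|N. LINT s|M. F s y)"
proof -
  interpret sigma_finite_measure M by fact
  interpret N: sigma_finite_measure N by fact
  interpret pair_sigma_finite M N ..
  have int: "integrable (M \<Otimes>\<^sub>M N) (case_prod F)"
  proof (rule Bochner_Integration.integrable_bound[OF integrable_pair_mult[OF assms(1,2) f g] F])
    show "AE z in M \<Otimes>\<^sub>M N. norm (case_prod F z) \<le> norm (case z of (s, y) \<Rightarrow> f s * g y)"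
    proof (intro AE_I2)
      fix z assume "z \<in> space (M \<Otimes>\<^sub>M N)"
      then show "norm (case_prod F z) \<le> norm (case z of (s, y) \<Rightarrow> f s * g y)"
        using le[of "fst z" "snd z"] by (auto simp: space_pair_measure)
    qed
  qed
  show "integrable M (\<lambda>s. LINT y|N. F s y)"
    by (rule integrable_fst[OF int])
  show "(LINT s|M. LINT y|N. F s y) = (LINT y|N. LINT s|M. F s y)"
    by (rule Fubini_integral[OF int, symmetric])
qed

text \<open>
  This is det (I - BA) = det (I - AB), term by term: expanding the n-th determinant by rows for L
  and by columns for K, both n-th terms are integrals over all tuples s and y of the same function
  G n s y, taken in opposite orders.
\<close>

lemma has_fredholm_det_commute:
  fixes A :: "'a \<Rightarrow> 'b \<Rightarrow> complex" and B :: "'b \<Rightarrow> 'a \<Rightarrow> complex"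
  assumes M: "sigma_finite_measure M" and N: "sigma_finite_measure N"
    and A: "(\<lambda>(s, y). A s y) \<in> borel_measurable (M \<Otimes>\<^sub>M N)"
    and B: "(\<lambda>(s, y). B y s) \<in> borel_measurable (M \<Otimes>\<^sub>M N)"
    and A_le: "\<And>s y. s \<in> space M \<Longrightarrow> y \<in> space N \<Longrightarrow> cmod (A s y) \<le> f s * g y"
    and B_le: "\<And>s y. s \<in> space M \<Longrightarrow> y \<in> space N \<Longrightarrow> cmod (B y s) \<le> f' s * g' y"
    and f: "integrable M (\<lambda>s. f s * f' s)" and g: "integrable N (\<lambda>y. g y * g' y)"
    and K: "\<And>y y'. y \<in> space N \<Longrightarrow> y' \<in> space N \<Longrightarrow> K y y' = (LINT s|M. B y s * A s y')"
    and L: "\<And>s t. s \<in> space M \<Longrightarrow> t \<in> space M \<Longrightarrow> L s t = (LINT y|N. A s y * B y t)"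
    and det: "has_fredholm_det N K D"
  shows "has_fredholm_det M L D"
proof -
  interpret M: sigma_finite_measure M by fact
  interpret N: sigma_finite_measure N by fact
  interpret MP: product_sigma_finite "\<lambda>_. M" by standard
  interpret NP: product_sigma_finite "\<lambda>_. N" by standard
  have Ac: "A s \<in> borel_measurable N" if "s \<in> space M" for s
    using measurable_compose[OF measurable_Pair1'[OF that] A] by simp
  have Bc: "(\<lambda>y. B y s) \<in> borel_measurable N" if "s \<in> space M" for s
    using measurable_compose[OF measurable_Pair1'[OF that] B] by simp
  have Ac': "(\<lambda>s. A s y) \<in> borel_measurable M" if "y \<in> space N" for y
    using measurable_compose[OF measurable_Pair2'[OF that] A] by simp
  have Bc': "B y \<in> borel_measurable M" if "y \<in> space N" for y
    using measurable_compose[OF measurable_Pair2'[OF that] B] by simp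
  \<comment> \<open>The single factors may have either sign; \<open>f s * g y\<close> and
    \<open>f' t * g' y'\<close> are nonnegative because each bounds a modulus.\<close>
  have AB_le: "cmod (A s y * B y' t) \<le> (f s * g y) * (f' t * g' y')"
    if "s \<in> space M" "t \<in> space M" "y \<in> space N" "y' \<in> space N" for s t y y'
    unfolding norm_mult
    using that A_le[of s y] B_le[of t y'] norm_ge_zero[of "A s y"]
    by (intro mult_mono A_le B_le) (auto intro: order_trans[OF norm_ge_zero])
  have intN: "integrable N (\<lambda>y. A s y * B y t)" if "s \<in> space M" "t \<in> space M" for s t
  proof (rule Bochner_Integration.integrable_bound)
    show "integrable N (\<lambda>y. f s * f' t * (g y * g' y))"
      using g by simp
    show "(\<lambda>y. A s y * B y t) \<in> borel_measurable N"
      by (intro borel_measurable_times Ac Bc that)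
    show "AE y in N. norm (A s y * B y t) \<le> norm (f s * f' t * (g y * g' y))"
    proof (intro AE_I2)
      fix y assume "y \<in> space N"
      then have "norm (A s y * B y t) \<le> f s * g y * (f' t * g' y)"
        using that by (intro AB_le)
      also have "\<dots> = f s * f' t * (g y * g' y)" by simp
      finally show "norm (A s y * B y t) \<le> norm (f s * f' t * (g y * g' y))" by simp
    qed
  qed
  have intM: "integrable M (\<lambda>s. A s y * B y' s)" if "y \<in> space N" "y' \<in> space N" for y y'
  proof (rule Bochner_Integration.integrable_bound)
    show "integrable M (\<lambda>s. g y * g' y' * (f s * f' s))"
      using f by simp
    show "(\<lambda>s. A s y * B y' s) \<in> borel_measurable M"
      by (intro borel_measurable_times Ac' Bc' that)
    show "AE s in M. norm (A s y * B y' s) \<le> norm (g y * g' y' * (f s * f' s))"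
    proof (intro AE_I2)
      fix s assume "s \<in> space M"
      then have "norm (A s y * B y' s) \<le> f s * g y * (f' s * g' y')"
        using that by (intro AB_le)
      also have "\<dots> = g y * g' y' * (f s * f' s)" by simp
      finally show "norm (A s y * B y' s) \<le> norm (g y * g' y' * (f s * f' s))" by simp
    qed
  qed
  \<comment> \<open>\<open>y i\<close> occurs in row i only, so integrating over y gives the
    determinant of L. But \<open>s i\<close> occurs in row i and in column i, so the K side reaches
    this form only after a transposition.\<close>
  define G where "G n s y = Determinant.det (mat n n (\<lambda>(i, j). A (s i) (y i) * B (y i) (s j)))"
    for n and s :: "nat \<Rightarrow> 'a" and y :: "nat \<Rightarrow> 'b"
  have detL: "Determinant.det (mat n n (\<lambda>(i, j). L (s i) (s j))) =
      (LINT y|PiM {..<n} (\<lambda>_. N). G n s y)" if "s \<in> space (PiM {..<n} (\<lambda>_. M))" for n s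
  proof -
    have s: "i < n \<Longrightarrow> s i \<in> space M" for i
      using that by (auto simp: space_PiM)
    have "mat n n (\<lambda>(i, j). L (s i) (s j)) = mat n n (\<lambda>(i, j). LINT y|N. A (s i) y * B y (s j))"
      by (intro eq_matI) (auto intro!: L s)
    then show ?thesis
      unfolding G_def by (simp add: det_mat_lebesgue_integral[OF N] intN s)
  qed
  have detK: "Determinant.det (mat n n (\<lambda>(i, j). K (y i) (y j))) =
      (LINT s|PiM {..<n} (\<lambda>_. M). G n s y)" if "y \<in> space (PiM {..<n} (\<lambda>_. N))" for n y
  proof -
    have y: "i < n \<Longrightarrow> y i \<in> space N" for i
      using that by (auto simp: space_PiM)
    have "mat n n (\<lambda>(i, j). K (y j) (y i)) = mat n n (\<lambda>(i, j). LINT s|M. A s (y i) * B (y j) s)"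
      by (intro eq_matI) (auto simp: K y mult.commute)
    then have "Determinant.det (mat n n (\<lambda>(i, j). K (y i) (y j))) =
        (LINT s|PiM {..<n} (\<lambda>_. M). Determinant.det (mat n n (\<lambda>(i, j). A (s i) (y i) * B (y j) (s i))))"
      by (subst det_mat_transpose[symmetric]) (simp add: det_mat_lebesgue_integral[OF M] intM y)
    also have "\<dots> = (LINT s|PiM {..<n} (\<lambda>_. M). G n s y)"
    proof (intro Bochner_Integration.integral_cong refl)
      fix s :: "nat \<Rightarrow> 'a"
      \<comment> \<open>Once \<open>A (s i) (y i)\<close> is pulled out of row i, the two
        determinants differ by transposing the matrix of values of B.\<close>
      have row: "Determinant.det (mat n n (\<lambda>(i, j). A (s i) (y i) * b i j)) =
        (\<Prod>i<n. A (s i) (y i)) * Determinant.det (mat n n (\<lambda>(i, j). b i j))" for b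
        by (simp add: det_mat_Leibniz prod.distrib sum_distrib_left mult_ac)
      show "Determinant.det (mat n n (\<lambda>(i, j). A (s i) (y i) * B (y j) (s i))) = G n s y"
        unfolding G_def row by (subst det_mat_transpose) rule
    qed
    finally show ?thesis .
  qed
  \<comment> \<open>In a Leibniz term each \<open>s i\<close> is used once by A in its row and once
    by B in its column; reindexing along p makes the bound independent of p.\<close>
  have G_le: "cmod (G n s y) \<le> (fact n * (\<Prod>i<n. f (s i) * f' (s i))) * (\<Prod>i<n. g (y i) * g' (y i))"
    if "s \<in> space (PiM {..<n} (\<lambda>_. M))" "y \<in> space (PiM {..<n} (\<lambda>_. N))" for n s y
    unfolding G_def mult.assoc
  proof (rule cmod_det_mat_le)
    fix p assume p: "p permutes {..<n}"
    have sy: "s i \<in> space M" "y i \<in> space N" if "i < n" for i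
      using that \<open>s \<in> _\<close> \<open>y \<in> _\<close> by (auto simp: space_PiM)
    have "(\<Prod>i<n. cmod (case (i, p i) of (i, j) \<Rightarrow> A (s i) (y i) * B (y i) (s j))) \<le>
      (\<Prod>i<n. f (s i) * g (y i) * (f' (s (p i)) * g' (y i)))"
      using permutes_in_image[OF p] unfolding prod.case
      by (intro prod_mono conjI norm_ge_zero AB_le sy) auto
    also have "\<dots> = (\<Prod>i<n. f (s i) * (g (y i) * g' (y i))) * (\<Prod>i<n. f' (s (p i)))"
      by (simp add: prod.distrib mult_ac)
    also have "(\<Prod>i<n. f' (s (p i))) = (\<Prod>i<n. f' (s i))"
      using prod.permute[OF p, of "\<lambda>i. f' (s i)"] by (simp add: o_def)
    also have "(\<Prod>i<n. f (s i) * (g (y i) * g' (y i))) * (\<Prod>i<n. f' (s i)) =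
      (\<Prod>i<n. f (s i) * f' (s i)) * (\<Prod>i<n. g (y i) * g' (y i))"
      by (simp add: prod.distrib mult_ac)
    finally show "(\<Prod>i<n. cmod (case (i, p i) of (i, j) \<Rightarrow> A (s i) (y i) * B (y i) (s j))) \<le>
      (\<Prod>i<n. f (s i) * f' (s i)) * (\<Prod>i<n. g (y i) * g' (y i))" .
  qed
  have G_meas: "(\<lambda>(s, y). G n s y) \<in>
      borel_measurable (PiM {..<n} (\<lambda>_. M) \<Otimes>\<^sub>M PiM {..<n} (\<lambda>_. N))" (is "_ \<in> borel_measurable ?P") for n
  proof -
    have "(\<lambda>z. A (fst z i) (snd z i) * B (snd z i) (fst z j)) \<in> borel_measurable ?P"
      if "i < n" "j < n" for i j
    proof -
      have 1: "(\<lambda>z. (fst z k, snd z i)) \<in> ?P \<rightarrow>\<^sub>M M \<Otimes>\<^sub>M N" if "k < n" for k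
        using that \<open>i < n\<close>
        by (intro measurable_Pair measurable_compose[OF measurable_fst]
            measurable_compose[OF measurable_snd] measurable_component_singleton) auto
      show ?thesis
        using measurable_compose[OF 1[OF that(1)] A] measurable_compose[OF 1[OF that(2)] B] by simp
    qed
    then have "(\<lambda>z. G n (fst z) (snd z)) \<in> borel_measurable ?P"
      unfolding G_def by (intro borel_measurable_det_mat)
    moreover have "(\<lambda>(s, y). G n s y) = (\<lambda>z. G n (fst z) (snd z))"
      by (simp add: fun_eq_iff)
    ultimately show ?thesis by simp
  qed
  have fin: "integrable (PiM {..<n} (\<lambda>_. M)) (\<lambda>s. fact n * (\<Prod>i<n. f (s i) * f' (s i)))"
    "integrable (PiM {..<n} (\<lambda>_. N)) (\<lambda>y. \<Prod>i<n. g (y i) * g' (y i))" for n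
    by (intro integrable_mult_right MP.product_integrable_prod f finite_lessThan,
        intro NP.product_integrable_prod g finite_lessThan)
  have swap: "integrable (PiM {..<n} (\<lambda>_. M)) (\<lambda>s. LINT y|PiM {..<n} (\<lambda>_. N). G n s y)"
    "(LINT s|PiM {..<n} (\<lambda>_. M). LINT y|PiM {..<n} (\<lambda>_. N). G n s y) =
      (LINT y|PiM {..<n} (\<lambda>_. N). LINT s|PiM {..<n} (\<lambda>_. M). G n s y)" for n
    by (rule integral_swap_of_bound[where f = "\<lambda>s. fact n * (\<Prod>i<n. f (s i) * f' (s i))"
          and g = "\<lambda>y. \<Prod>i<n. g (y i) * g' (y i)"];
        intro MP.sigma_finite NP.sigma_finite G_meas fin G_le finite_lessThan; assumption)+
  have "integrable (PiM {..<n} (\<lambda>_. M)) (\<lambda>s. Determinant.det (mat n n (\<lambda>(i, j). L (s i) (s j))))" for n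
    using swap(1)[of n] by (subst Bochner_Integration.integrable_cong[OF refl detL]) auto
  moreover have "(LINT s|PiM {..<n} (\<lambda>_. M). Determinant.det (mat n n (\<lambda>(i, j). L (s i) (s j)))) =
    (LINT y|PiM {..<n} (\<lambda>_. N). Determinant.det (mat n n (\<lambda>(i, j). K (y i) (y j))))" for n
    using swap(2)[of n] by (simp add: detL detK cong: Bochner_Integration.integral_cong)
  ultimately show ?thesis
    using det unfolding has_fredholm_det_def by simp
qed


section \<open>Convergence of the Fredholm series over a countable set\<close>

lemma fact_le_prod_Suc:
  assumes "finite A"
  shows "fact (card A) \<le> (\<Prod>k\<in>A. Suc k)"
  using assms
proof (induction "card A" arbitrary: A)
  case (Suc n)
  then have A: "A \<noteq> {}" "finite A" by auto
  \<comment> \<open>The induction removes the largest element, which is at least n in a set of n + 1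
    natural numbers.\<close>
  have "card A \<le> card {..Max A}"
    using A by (intro card_mono) auto
  then have "Suc n \<le> Suc (Max A)"
    using Suc.hyps by simp
  moreover have "fact n \<le> (\<Prod>k\<in>A - {Max A}. Suc k)"
    using Suc.hyps(1)[of "A - {Max A}"] A by (simp flip: Suc.hyps(2))
  ultimately have "Suc n * fact n \<le> Suc (Max A) * (\<Prod>k\<in>A - {Max A}. Suc k)"
    by (rule mult_le_mono)
  then show ?case
    using A by (simp add: Suc.hyps(2)[symmetric] prod.remove[of A "Max A"])
qed auto

text \<open>Countability makes every function of a pair measurable for the product sigma-algebra,
  whatever K is.\<close>

lemma borel_measurable_PiM_count_space_pair:
  fixes K :: "'b \<Rightarrow> 'b \<Rightarrow> complex"
  assumes "countable S" "i \<in> I" "j \<in> I"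
  shows "(\<lambda>y. K (y i) (y j)) \<in> borel_measurable (PiM I (\<lambda>_. count_space S))"
proof -
  have "(\<lambda>y. (y i, y j)) \<in> PiM I (\<lambda>_. count_space S) \<rightarrow>\<^sub>M count_space S \<Otimes>\<^sub>M count_space S"
    using assms by (intro measurable_Pair measurable_component_singleton)
  moreover have "(\<lambda>(y, y'). K y y') \<in> borel_measurable (count_space S \<Otimes>\<^sub>M count_space S)"
    using assms by (intro measurable_pair_measure_countable1) auto
  ultimately show ?thesis
    using measurable_compose by fastforce
qed

text \<open>
  The determinants vanish on tuples with a repeated entry, and for distinct indices k the product
  of the numbers Suc k is at least n!.  This absorbs the n! terms of the determinant, so that
  Hadamard's inequality is not needed.
\<close>

lemma has_fredholm_det_count_space_exists:
  fixes e :: "nat \<Rightarrow> 'b" and K :: "'b \<Rightarrow> 'b \<Rightarrow> complex"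
  assumes e: "bij_betw e UNIV S"
    and K: "\<And>y y'. y \<in> S \<Longrightarrow> y' \<in> S \<Longrightarrow> cmod (K y y') \<le> q y * q y'"
    and q: "\<And>k. (q (e k))\<^sup>2 \<le> C / 4 ^ k"
  shows "\<exists>D. has_fredholm_det (count_space S) K D"
proof -
  have S: "countable S"
    using bij_betw_imp_surj_on[OF e] by (metis countable_image countableI_type)
  interpret sigma_finite_measure "count_space S"
    by (rule sigma_finite_measure_count_space_countable[OF S])
  interpret product_sigma_finite "\<lambda>_. count_space S" by standard
  have eS: "e k \<in> S" for k
    using bij_betwE[OF e] by auto
  define r where "r = inv_into UNIV e"
  have er: "e (r y) = y" if "y \<in> S" for y
    unfolding r_def using that bij_betw_inv_into_right[OF e] by auto
  \<comment> \<open>Of the factor 4^k in the hypothesis, one 2^k pays for the \<open>Suc k\<close>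
    that absorbs n!, and the other 2^k keeps w summable.\<close>
  define w where "w y = C / 2 ^ r y" for y
  have int_w: "integrable (count_space S) w"
  proof -
    have "r (e k) = k" for k
      unfolding r_def using bij_betw_inv_into_left[OF e] by auto
    then have "integrable (count_space UNIV) (\<lambda>k. w (e k))"
      using summable_mult[OF summable_geometric[of "1/2::real"], of "\<bar>C\<bar>"]
      by (simp add: w_def integrable_count_space_nat_iff power_divide abs_mult)
    then show ?thesis
      by (simp add: integrable_bij_count_space[OF e])
  qed
  define W where "W = (LINT y|count_space S. w y)"
  let ?d = "\<lambda>n y. Determinant.det (mat n n (\<lambda>(i, j). K (y i) (y j)))"
  let ?P = "\<lambda>n::nat. PiM {..<n} (\<lambda>_. count_space S)"
  have le: "cmod (?d n y) \<le> (\<Prod>i<n. w (y i))" if "y \<in> space (?P n)" for n y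
  proof (cases "inj_on y {..<n}")
    case False
    moreover have "0 \<le> w x" for x
      using order_trans[OF zero_le_power2 q[of 0]] by (simp add: w_def)
    ultimately show ?thesis
      by (simp add: det_mat_eq_0_if_not_inj prod_nonneg)
  next
    case True
    have y: "y i \<in> S" if "i < n" for i
      using that \<open>y \<in> _\<close> by (auto simp: space_PiM)
    have "cmod (?d n y) \<le> fact n * (\<Prod>i<n. (q (y i))\<^sup>2)"
    proof (rule cmod_det_mat_le)
      fix p assume p: "p permutes {..<n}"
      have "(\<Prod>i<n. cmod (case (i, p i) of (i, j) \<Rightarrow> K (y i) (y j))) \<le> (\<Prod>i<n. q (y i) * q (y (p i)))"
        unfolding prod.case using permutes_in_image[OF p] by (intro prod_mono conjI norm_ge_zero K y) auto
      also have "\<dots> = (\<Prod>i<n. q (y i)) * (\<Prod>i<n. q (y i))"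
        using prod.permute[OF p, of "\<lambda>i. q (y i)"] by (simp add: prod.distrib o_def)
      finally show "(\<Prod>i<n. cmod (case (i, p i) of (i, j) \<Rightarrow> K (y i) (y j))) \<le> (\<Prod>i<n. (q (y i))\<^sup>2)"
        by (simp add: power2_eq_square prod.distrib)
    qed
    also have "\<dots> \<le> (\<Prod>i<n. real (Suc (r (y i)))) * (\<Prod>i<n. (q (y i))\<^sup>2)"
    proof (intro mult_right_mono prod_nonneg)
      have inj: "inj_on (\<lambda>i. r (y i)) {..<n}"
        by (rule inj_onI) (metis True er y inj_onD lessThan_iff)
      have "fact n \<le> (\<Prod>k\<in>(\<lambda>i. r (y i)) ` {..<n}. Suc k)"
        using fact_le_prod_Suc[of "(\<lambda>i. r (y i)) ` {..<n}"] by (simp add: card_image[OF inj])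
      also have "\<dots> = (\<Prod>i<n. Suc (r (y i)))"
        by (simp add: prod.reindex[OF inj])
      finally have "real (fact n) \<le> real (\<Prod>i<n. Suc (r (y i)))"
        by (rule of_nat_mono)
      then show "fact n \<le> (\<Prod>i<n. real (Suc (r (y i))))"
        by simp
    qed auto
    also have "\<dots> = (\<Prod>i<n. real (Suc (r (y i))) * (q (y i))\<^sup>2)"
      by (simp add: prod.distrib)
    also have "\<dots> \<le> (\<Prod>i<n. w (y i))"
    proof (intro prod_mono conjI)
      fix i assume "i \<in> {..<n}"
      then have "(q (y i))\<^sup>2 \<le> C / 4 ^ r (y i)"
        using q[of "r (y i)"] er[OF y] by simp
      moreover have "Suc k \<le> 2 ^ k" for k :: nat
        using Suc_leI[OF less_exp[of k]] .
      then have "real (Suc (r (y i))) \<le> 2 ^ r (y i)"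
        using of_nat_mono[of "Suc (r (y i))" "2 ^ r (y i)", where 'a = real] by simp
      ultimately have "real (Suc (r (y i))) * (q (y i))\<^sup>2 \<le> 2 ^ r (y i) * (C / 4 ^ r (y i))"
        by (intro mult_mono) auto
      also have "\<dots> = w (y i)"
        using power_mult_distrib[of "2::real" 2 "r (y i)"] by (simp add: w_def)
      finally show "real (Suc (r (y i))) * (q (y i))\<^sup>2 \<le> w (y i)" .
    qed simp
    finally show ?thesis .
  qed
  have int_prod: "integrable (?P n) (\<lambda>y. \<Prod>i<n. w (y i))" for n
    by (intro product_integrable_prod int_w finite_lessThan)
  have int: "integrable (?P n) (?d n)" for n
  proof (rule Bochner_Integration.integrable_bound[OF int_prod])
    show "?d n \<in> borel_measurable (?P n)"
      using S by (intro borel_measurable_det_mat borel_measurable_PiM_count_space_pair) auto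
    show "AE y in ?P n. norm (?d n y) \<le> norm (\<Prod>i<n. w (y i))"
      by (intro AE_I2 order_trans[OF le]) auto
  qed
  \<comment> \<open>Since w has absorbed the n! of the determinant, the 1/n! of the Fredholm series
    survives, and the exponential series of W dominates.\<close>
  have "cmod ((-1) ^ n / fact n * (LINT y|?P n. ?d n y)) \<le> W ^ n /\<^sub>R fact n" for n
  proof -
    have "cmod (LINT y|?P n. ?d n y) \<le> (LINT y|?P n. (\<Prod>i<n. w (y i)))"
      by (rule order_trans[OF integral_norm_bound])
        (intro integral_mono integrable_norm int int_prod le)
    also have "\<dots> = W ^ n"
      by (subst product_integral_prod) (auto simp: int_w W_def)
    finally show ?thesis
      by (simp add: norm_mult norm_divide norm_power divide_simps)
  qed
  then have "summable (\<lambda>n. (-1) ^ n / fact n * (LINT y|?P n. ?d n y))"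
    by (intro summable_comparison_test'[OF summable_exp_generic[of W]])
  then show ?thesis
    unfolding has_fredholm_det_def using int by (auto intro: summable_sums)
qed


section \<open>Trace class integral operators\<close>

text \<open>Cauchy-Schwarz: expand the nonnegative integral of (b f - a g)^2, where a and b are the
  norms of f and g, and divide by 2ab. If a norm is 0, that function vanishes almost
  everywhere.\<close>

lemma integral_mult_le_sqrt:
  fixes f g :: "'a \<Rightarrow> real"
  assumes f: "integrable M (\<lambda>x. (f x)\<^sup>2)" and g: "integrable M (\<lambda>x. (g x)\<^sup>2)"
    and meas[measurable]: "f \<in> borel_measurable M" "g \<in> borel_measurable M"
  shows "integrable M (\<lambda>x. f x * g x)"
    and "(LINT x|M. f x * g x) \<le> sqrt (LINT x|M. (f x)\<^sup>2) * sqrt (LINT x|M. (g x)\<^sup>2)"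
proof -
  show int: "integrable M (\<lambda>x. f x * g x)"
  proof (rule Bochner_Integration.integrable_bound)
    show "integrable M (\<lambda>x. (f x)\<^sup>2 + (g x)\<^sup>2)"
      using f g by simp
    have "\<bar>a * b\<bar> \<le> a\<^sup>2 + b\<^sup>2" for a b :: real
      using sum_squares_bound[of "\<bar>a\<bar>" "\<bar>b\<bar>"] mult_nonneg_nonneg[of "\<bar>a\<bar>" "\<bar>b\<bar>"]
      unfolding abs_mult power2_abs by linarith
    then show "AE x in M. norm (f x * g x) \<le> norm ((f x)\<^sup>2 + (g x)\<^sup>2)"
      by simp
  qed measurable
  define a where "a = sqrt (LINT x|M. (f x)\<^sup>2)"
  define b where "b = sqrt (LINT x|M. (g x)\<^sup>2)"
  have a2: "(LINT x|M. (f x)\<^sup>2) = a\<^sup>2" and b2: "(LINT x|M. (g x)\<^sup>2) = b\<^sup>2"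
    by (simp_all add: a_def b_def)
  have "0 \<le> a" "0 \<le> b" by (simp_all add: a_def b_def)
  show "(LINT x|M. f x * g x) \<le> a * b"
  proof (cases "a = 0 \<or> b = 0")
    case True
    then have "(AE x in M. (f x)\<^sup>2 = 0) \<or> (AE x in M. (g x)\<^sup>2 = 0)"
      using integral_nonneg_eq_0_iff_AE[OF f] integral_nonneg_eq_0_iff_AE[OF g]
      by (auto simp: a2 b2)
    then have "AE x in M. f x * g x = 0"
      by auto
    then show ?thesis
      using True by (subst integral_cong_AE[where g = "\<lambda>_. 0"]) auto
  next
    case False
    then have ab: "0 < a * b" using \<open>0 \<le> a\<close> \<open>0 \<le> b\<close> by simp
    have "0 \<le> (LINT x|M. (b * f x - a * g x)\<^sup>2)"
      by (rule Bochner_Integration.integral_nonneg) simp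
    also have "(\<lambda>x. (b * f x - a * g x)\<^sup>2) =
        (\<lambda>x. b\<^sup>2 * (f x)\<^sup>2 + a\<^sup>2 * (g x)\<^sup>2 - 2 * (a * b) * (f x * g x))"
      by (simp add: fun_eq_iff power2_eq_square algebra_simps)
    also have "(LINT x|M. b\<^sup>2 * (f x)\<^sup>2 + a\<^sup>2 * (g x)\<^sup>2 - 2 * (a * b) * (f x * g x)) =
        b\<^sup>2 * a\<^sup>2 + a\<^sup>2 * b\<^sup>2 - 2 * (a * b) * (LINT x|M. f x * g x)"
      using f g int by (simp add: a2 b2)
    also have "\<dots> = 2 * (a * b) * (a * b - (LINT x|M. f x * g x))"
      by (simp add: power2_eq_square algebra_simps)
    finally show ?thesis
      using ab by (simp add: zero_le_mult_iff)
  qed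
qed

text \<open>Cauchy-Schwarz in t bounds the image of f pointwise by c h(s) |h| |f|, which is again
  square integrable. The resulting norm bound is linear in c, so small remainders of an expansion
  give small operator norms.\<close>

lemma kernel_op_bounded:
  fixes K :: "'a \<Rightarrow> 'a \<Rightarrow> complex"
  assumes "sigma_finite_measure M"
    and K[measurable]: "case_prod K \<in> borel_measurable (M \<Otimes>\<^sub>M M)"
    and h[measurable]: "h \<in> borel_measurable M" and h2: "integrable M (\<lambda>x. (h x)\<^sup>2)"
    and h0: "\<And>x. 0 \<le> h x" and c0: "0 \<le> c"
    and K_le: "\<And>s t. s \<in> space M \<Longrightarrow> t \<in> space M \<Longrightarrow> cmod (K s t) \<le> c * h s * h t"
  shows integrable_kernel_op:
      "\<And>f s. f \<in> L2_fun M \<Longrightarrow> s \<in> space M \<Longrightarrow> integrable M (\<lambda>t. K s t * f t)"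
    and L2_nrm_kernel_op_le:
      "\<And>f. f \<in> L2_fun M \<Longrightarrow> L2_nrm M (kernel_op M K f) \<le> c * (LINT x|M. (h x)\<^sup>2) * L2_nrm M f"
    and bounded_L2_op_kernel_op: "bounded_L2_op M (kernel_op M K)"
proof -
  interpret sigma_finite_measure M by fact
  have Kc: "K s \<in> borel_measurable M" if "s \<in> space M" for s
    using measurable_compose[OF measurable_Pair1'[OF that] K] by simp
  define H where "H = (LINT x|M. (h x)\<^sup>2)"
  have H0: "0 \<le> H" by (simp add: H_def)
  have L2: "f \<in> borel_measurable M" "integrable M (\<lambda>x. (cmod (f x))\<^sup>2)"
    "(\<lambda>x. cmod (f x)) \<in> borel_measurable M" if "f \<in> L2_fun M" for f
    using that by (auto simp: L2_fun_def)
  have le: "cmod (K s t * f t) \<le> c * h s * (h t * cmod (f t))" if "s \<in> space M" "t \<in> space M" for s t f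
    using mult_right_mono[OF K_le[OF that] norm_ge_zero[of "f t"]] by (simp add: norm_mult mult.assoc)
  show int: "integrable M (\<lambda>t. K s t * f t)" if f: "f \<in> L2_fun M" and s: "s \<in> space M" for f s
  proof (rule Bochner_Integration.integrable_bound)
    show "integrable M (\<lambda>t. c * h s * (h t * cmod (f t)))"
      by (intro integrable_mult_right integral_mult_le_sqrt h2 h L2 f)
    show "(\<lambda>t. K s t * f t) \<in> borel_measurable M"
      by (intro borel_measurable_times Kc s L2 f)
    show "AE t in M. norm (K s t * f t) \<le> norm (c * h s * (h t * cmod (f t)))"
      by (intro AE_I2) (use le[OF s, of _ f] in \<open>force intro: order_trans[OF _ abs_ge_self]\<close>)
  qed
  have op_le: "cmod (kernel_op M K f s) \<le> c * sqrt H * L2_nrm M f * h s"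
    if f: "f \<in> L2_fun M" and s: "s \<in> space M" for f s
  proof -
    have "cmod (kernel_op M K f s) \<le> (LINT t|M. cmod (K s t * f t))"
      unfolding kernel_op_def by (rule integral_norm_bound)
    also have "\<dots> \<le> (LINT t|M. c * h s * (h t * cmod (f t)))"
      by (intro integral_mono integrable_norm int f s le integrable_mult_right
          integral_mult_le_sqrt h2 h L2)
    also have "\<dots> = c * h s * (LINT t|M. h t * cmod (f t))"
      by simp
    also have "\<dots> \<le> c * h s * (sqrt H * L2_nrm M f)"
      unfolding H_def L2_nrm_def
      by (intro mult_left_mono integral_mult_le_sqrt h2 h L2 f mult_nonneg_nonneg c0 h0)
    finally show ?thesis by (simp add: mult_ac)
  qed
  have op_L2: "kernel_op M K f \<in> L2_fun M"
    and nrm: "L2_nrm M (kernel_op M K f) \<le> c * H * L2_nrm M f" if f: "f \<in> L2_fun M" for f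
  proof -
    note [measurable] = L2(1)[OF f]
    have [measurable]: "kernel_op M K f \<in> borel_measurable M"
      unfolding kernel_op_def by measurable
    let ?C = "c * sqrt H * L2_nrm M f"
    have C0: "0 \<le> ?C"
      using c0 H0 by (simp add: L2_nrm_def)
    have sq: "(cmod (kernel_op M K f s))\<^sup>2 \<le> ?C\<^sup>2 * (h s)\<^sup>2" if "s \<in> space M" for s
      using power_mono[OF op_le[OF f that] norm_ge_zero, of 2] by (simp add: power_mult_distrib)
    have int2: "integrable M (\<lambda>s. (cmod (kernel_op M K f s))\<^sup>2)"
    proof (rule Bochner_Integration.integrable_bound)
      show "integrable M (\<lambda>s. ?C\<^sup>2 * (h s)\<^sup>2)" using h2 by simp
      show "AE s in M. norm ((cmod (kernel_op M K f s))\<^sup>2) \<le> norm (?C\<^sup>2 * (h s)\<^sup>2)"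
        using sq by (intro AE_I2) simp
    qed measurable
    then show "kernel_op M K f \<in> L2_fun M"
      by (simp add: L2_fun_def)
    have "(LINT s|M. (cmod (kernel_op M K f s))\<^sup>2) \<le> (LINT s|M. ?C\<^sup>2 * (h s)\<^sup>2)"
      using h2 by (intro integral_mono int2 sq) auto
    also have "\<dots> = (?C * sqrt H)\<^sup>2"
      using H0 by (simp add: H_def power_mult_distrib)
    finally have "L2_nrm M (kernel_op M K f) \<le> ?C * sqrt H"
      unfolding L2_nrm_def[of M "kernel_op M K f"]
      using C0 H0 by (intro real_le_lsqrt) auto
    also have "\<dots> = c * (sqrt H * sqrt H) * L2_nrm M f"
      by (simp only: mult_ac)
    also have "\<dots> = c * H * L2_nrm M f"
      using H0 by simp
    finally show "L2_nrm M (kernel_op M K f) \<le> c * H * L2_nrm M f" .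
  qed
  show "\<And>f. f \<in> L2_fun M \<Longrightarrow> L2_nrm M (kernel_op M K f) \<le> c * (LINT x|M. (h x)\<^sup>2) * L2_nrm M f"
    using nrm by (simp add: H_def)
  show "bounded_L2_op M (kernel_op M K)"
    unfolding bounded_L2_op_def
  proof (intro conjI ballI allI exI AE_I2)
    fix f g s assume "f \<in> L2_fun M" "g \<in> L2_fun M" "s \<in> space M"
    then show "kernel_op M K (\<lambda>y. f y + g y) s = kernel_op M K f s + kernel_op M K g s"
      unfolding kernel_op_def distrib_left by (intro Bochner_Integration.integral_add int)
  next
    fix d f s
    show "kernel_op M K (\<lambda>y. d * f y) s = d * kernel_op M K f s"
      unfolding kernel_op_def mult.left_commute[of _ d] by simp
  qed (use op_L2 nrm in auto)
qed

text \<open>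
  The partial sums of the expansion have rank at most n, so the remainder bound r n controls the
  singular value with index n; no trace-ideal theory is needed when r itself is summable.
\<close>

lemma trace_class_kernel_of_expansion:
  fixes K :: "'a \<Rightarrow> 'a \<Rightarrow> complex" and \<phi> :: "nat \<Rightarrow> 'a \<Rightarrow> complex"
  assumes M: "sigma_finite_measure M"
    and K[measurable]: "case_prod K \<in> borel_measurable (M \<Otimes>\<^sub>M M)"
    and h[measurable]: "h \<in> borel_measurable M" and h2: "integrable M (\<lambda>x. (h x)\<^sup>2)"
    and h0: "\<And>x. 0 \<le> h x"
    and \<phi>[measurable]: "\<And>k. \<phi> k \<in> borel_measurable M"
    and \<phi>_le: "\<And>k s. s \<in> space M \<Longrightarrow> cmod (\<phi> k s) \<le> h s"
    and r: "summable r" and r0: "\<And>n. 0 \<le> r n"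
    and rem: "\<And>n s t. s \<in> space M \<Longrightarrow> t \<in> space M \<Longrightarrow>
      cmod (K s t - (\<Sum>k<n. u k * \<phi> k s * \<phi> k t)) \<le> r n * h s * h t"
  shows "trace_class_kernel M K"
proof -
  note kb = kernel_op_bounded[OF M _ h h2 h0]
  define T where "T n s t = (\<Sum>k<n. u k * \<phi> k s * \<phi> k t)" for n s t
  define H where "H = (LINT x|M. (h x)\<^sup>2)"
  have T_meas: "case_prod (T n) \<in> borel_measurable (M \<Otimes>\<^sub>M M)" for n
    unfolding T_def by measurable
  have term_le: "cmod (u k * \<phi> k s * \<phi> k t) \<le> cmod (u k) * h s * h t"
    if "s \<in> space M" "t \<in> space M" for k s t
    unfolding norm_mult using that
    by (intro mult_mono \<phi>_le order_refl mult_nonneg_nonneg norm_ge_zero h0)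
  have T_le: "cmod (T n s t) \<le> (\<Sum>k<n. cmod (u k)) * h s * h t"
    if "s \<in> space M" "t \<in> space M" for n s t
    unfolding T_def sum_distrib_right by (rule sum_norm_le) (rule term_le[OF that])
  \<comment> \<open>The empty partial sum: the remainder bound at n = 0 bounds K itself.\<close>
  have K_le: "cmod (K s t) \<le> r 0 * h s * h t" if "s \<in> space M" "t \<in> space M" for s t
    using rem[OF that, of 0] by simp
  have D_le: "cmod (K s t - T n s t) \<le> r n * h s * h t" if "s \<in> space M" "t \<in> space M" for n s t
    unfolding T_def by (rule rem[OF that])
  have D_meas: "(\<lambda>(s, t). K s t - T n s t) \<in> borel_measurable (M \<Otimes>\<^sub>M M)" for n
    using T_meas[of n, measurable] by measurable
  have u0: "0 \<le> (\<Sum>k<n. cmod (u k))" for n by (simp add: sum_nonneg)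
  have Kop: "\<And>f s. f \<in> L2_fun M \<Longrightarrow> s \<in> space M \<Longrightarrow> integrable M (\<lambda>t. K s t * f t)"
    by (rule kb(1)[OF K r0 K_le])
  have Kbd: "bounded_L2_op M (kernel_op M K)"
    by (rule kb(3)[OF K r0 K_le])
  have Top: "\<And>f s. f \<in> L2_fun M \<Longrightarrow> s \<in> space M \<Longrightarrow> integrable M (\<lambda>t. T n s t * f t)" for n
    by (rule kb(1)[OF T_meas u0 T_le])
  have Tbd: "bounded_L2_op M (kernel_op M (T n))" for n
    by (rule kb(3)[OF T_meas u0 T_le])
  have Dle: "\<And>f. f \<in> L2_fun M \<Longrightarrow>
      L2_nrm M (kernel_op M (\<lambda>s t. K s t - T n s t) f) \<le> r n * H * L2_nrm M f" for n
    unfolding H_def by (rule kb(2)[OF D_meas r0 D_le])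
  \<comment> \<open>The range is spanned by the first n functions \<open>\<phi> k\<close>; the
    coefficients are \<open>u k\<close> times the bilinear pairing of \<open>\<phi> k\<close> with
    f, without conjugation.\<close>
  have rank: "rank_at_most M n (kernel_op M (T n))" for n
    unfolding rank_at_most_def
  proof (intro exI conjI ballI allI impI AE_I2)
    fix k :: nat
    show "\<phi> k \<in> L2_fun M"
      unfolding L2_fun_def
    proof (intro CollectI conjI \<phi> Bochner_Integration.integrable_bound[OF h2])
      show "AE x in M. norm ((cmod (\<phi> k x))\<^sup>2) \<le> norm ((h x)\<^sup>2)"
        using power_mono[OF \<phi>_le norm_ge_zero] by (intro AE_I2) simp
    qed measurable
  next
    fix f s assume f: "f \<in> L2_fun M" and s: "s \<in> space M"
    have "integrable M (\<lambda>t. u k * \<phi> k s * \<phi> k t * f t)" for k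
      by (rule integrable_kernel_op[OF M _ h h2 h0 _ term_le f s]) measurable
    moreover have eq: "(LINT t|M. u k * \<phi> k s * \<phi> k t * f t) = u k * (LINT t|M. \<phi> k t * f t) * \<phi> k s" for k
      unfolding mult.assoc[of "u k * \<phi> k s"] by simp
    ultimately show "kernel_op M (T n) f s = (\<Sum>k<n. (u k * (LINT t|M. \<phi> k t * f t)) * \<phi> k s)"
      unfolding kernel_op_def T_def sum_distrib_right
      by (subst Bochner_Integration.integral_sum) (auto simp: eq)
  qed
  have sv: "singular_value M (kernel_op M K) n \<le> r n * H"
    "0 \<le> singular_value M (kernel_op M K) n" for n
  proof -
    let ?S = "{C. 0 \<le> C \<and> (\<exists>F. bounded_L2_op M F \<and> rank_at_most M n F \<and>
            (\<forall>f \<in> L2_fun M. L2_nrm M (\<lambda>x. kernel_op M K f x - F f x) \<le> C * L2_nrm M f))}"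
    have "L2_nrm M (\<lambda>s. kernel_op M K f s - kernel_op M (T n) f s) \<le> r n * H * L2_nrm M f"
      if f: "f \<in> L2_fun M" for f
    proof -
      have "L2_nrm M (\<lambda>s. kernel_op M K f s - kernel_op M (T n) f s) =
        L2_nrm M (kernel_op M (\<lambda>s t. K s t - T n s t) f)"
        unfolding L2_nrm_def kernel_op_def
        by (intro arg_cong[of _ _ sqrt] Bochner_Integration.integral_cong refl)
          (simp add: left_diff_distrib Kop[OF f] Top[OF f])
      also have "\<dots> \<le> r n * H * L2_nrm M f"
        by (rule Dle[OF f])
      finally show ?thesis .
    qed
    moreover have "0 \<le> r n * H" using r0 by (simp add: H_def)
    \<comment> \<open>Membership gives the upper bound and also nonemptiness, without which the
      infimum would be an unspecified number.\<close>
    ultimately have mem: "r n * H \<in> ?S"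
      using Tbd rank by blast
    show "singular_value M (kernel_op M K) n \<le> r n * H"
      unfolding singular_value_def using mem by (intro cInf_lower bdd_belowI[of _ 0]) auto
    show "0 \<le> singular_value M (kernel_op M K) n"
      unfolding singular_value_def using mem by (intro cInf_greatest) auto
  qed
  have "summable (singular_value M (kernel_op M K))"
    using sv by (intro summable_comparison_test'[OF summable_mult2[OF r, of H]]) simp
  then show ?thesis
    unfolding trace_class_kernel_def trace_class_def
    using Kop Kbd by (auto intro!: AE_I2)
qed


section \<open>Exponential sums on the half line\<close>

lemma space_half_line [simp]: "space half_line = {0<..}"
  by (simp add: half_line_def space_restrict_space)

lemma sigma_finite_half_line: "sigma_finite_measure half_line"
  unfolding half_line_def by (intro sigma_finite_measure_restrict_space sigma_finite_lborel) auto

lemma borel_measurable_half_lineI: "f \<in> borel_measurable borel \<Longrightarrow> f \<in> borel_measurable half_line"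
  unfolding half_line_def by (intro measurable_restrict_space1) simp

lemma exp_half_line:
  fixes w :: complex
  assumes "Re w < 0"
  shows "integrable half_line (\<lambda>t. exp (complex_of_real t * w))"
    and "(LINT t|half_line. exp (complex_of_real t * w)) = - 1 / w"
proof -
  have w: "w \<noteq> 0" "Re w \<noteq> 0" using assms by auto
  have lim: "((\<lambda>t. exp (t * Re w)) \<longlongrightarrow> 0) at_top"
    by (rule filterlim_compose[OF exp_at_bot])
      (use assms in \<open>auto intro!: filterlim_tendsto_neg_mult_at_bot[where c = "Re w"] filterlim_ident simp: mult.commute[of _ "Re w"]\<close>)
  \<comment> \<open>Integrability is settled on the modulus, where the fundamental theorem for
    nonnegative functions applies; the value then comes from the complex antiderivative.\<close>
  have real: "set_integrable lborel {0<..} (\<lambda>t. exp (t * Re w))"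
  proof -
    have "set_integrable lborel (einterval 0 \<infinity>) (\<lambda>t. exp (t * Re w))"
    proof (rule interval_integral_FTC_nonneg(1)[where F = "\<lambda>t. exp (t * Re w) / Re w" and A = "1 / Re w" and B = 0])
      show "(((\<lambda>t. exp (t * Re w) / Re w) \<circ> real_of_ereal) \<longlongrightarrow> 1 / Re w) (at_right 0)"
        unfolding zero_ereal_def ereal_tendsto_simps
        by (auto intro!: tendsto_eq_intros simp: w)
      show "(((\<lambda>t. exp (t * Re w) / Re w) \<circ> real_of_ereal) \<longlongrightarrow> 0) (at_left \<infinity>)"
        unfolding ereal_tendsto_simps using tendsto_divide[OF lim tendsto_const[of "Re w"]] assms by simp
    qed (auto intro!: derivative_eq_intros continuous_intros simp: w)
    also have "einterval 0 \<infinity> = {0<..}"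
      by (auto simp: einterval_def)
    finally show ?thesis .
  qed
  have int: "set_integrable lborel {0<..} (\<lambda>t. exp (complex_of_real t * w))"
  proof (rule set_integrable_bound[OF real])
    show "set_borel_measurable lborel {0<..} (\<lambda>t. exp (complex_of_real t * w))"
      unfolding set_borel_measurable_def by measurable
  qed auto
  then show "integrable half_line (\<lambda>t. exp (complex_of_real t * w))"
    unfolding half_line_def by (simp add: integrable_restrict_space set_integrable_def)
  have "(LBINT t=0..\<infinity>. exp (complex_of_real t * w)) = 0 - 1 / w"
  proof (rule interval_integral_FTC_integrable[where F = "\<lambda>t. exp (complex_of_real t * w) / w"])
    fix t :: real
    have "((\<lambda>z. exp (z * w) / w) has_field_derivative exp (complex_of_real t * w)) (at (complex_of_real t))"
      using w by (auto intro!: derivative_eq_intros)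
    then show "((\<lambda>t. exp (complex_of_real t * w) / w) has_vector_derivative exp (complex_of_real t * w)) (at t)"
      using has_vector_derivative_real_field by blast
    show "isCont (\<lambda>t. exp (complex_of_real t * w)) t"
      by (intro continuous_intros)
  next
    show "set_integrable lborel (einterval 0 \<infinity>) (\<lambda>t. exp (complex_of_real t * w))"
      using int by (simp add: einterval_def greaterThan_def)
    show "(((\<lambda>t. exp (complex_of_real t * w) / w) \<circ> real_of_ereal) \<longlongrightarrow> 1 / w) (at_right 0)"
      unfolding zero_ereal_def ereal_tendsto_simps using w by (auto intro!: tendsto_eq_intros)
    have "((\<lambda>t. exp (complex_of_real t * w)) \<longlongrightarrow> 0) at_top"
      by (rule Lim_null_comparison[OF _ lim]) simp
    from tendsto_divide[OF this tendsto_const[of w]] w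
    show "(((\<lambda>t. exp (complex_of_real t * w) / w) \<circ> real_of_ereal) \<longlongrightarrow> 0) (at_left \<infinity>)"
      unfolding ereal_tendsto_simps by simp
  qed simp
  then show "(LINT t|half_line. exp (complex_of_real t * w)) = - 1 / w"
    unfolding half_line_def interval_lebesgue_integral_0_infty
    by (simp add: integral_restrict_space set_lebesgue_integral_def)
qed

lemma exp_real_half_line:
  fixes c :: real
  assumes "0 < c"
  shows "integrable half_line (\<lambda>t. exp (- c * t))"
proof -
  have "integrable half_line (\<lambda>t. exp (complex_of_real t * complex_of_real (- c)))"
    using assms by (intro exp_half_line) simp
  from integrable_norm[OF this] show ?thesis
    by (simp add: mult.commute)
qed

section \<open>Unordered sums as integrals over the counting measure\<close>

lemma infsum_eq_lebesgue_count_space: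
  fixes f :: "'b \<Rightarrow> complex"
  assumes "integrable (count_space S) f"
  shows "infsum f S = (LINT y|count_space S. f y)"
  using infsetsum_infsum[of f S] assms
  by (simp add: abs_summable_on_def infsetsum_def)

lemma borel_measurable_pair_count_space:
  fixes F :: "'a \<Rightarrow> 'b \<Rightarrow> complex"
  assumes "countable S" and "\<And>y. y \<in> S \<Longrightarrow> (\<lambda>x. F x y) \<in> borel_measurable M"
  shows "(\<lambda>(x, y). F x y) \<in> borel_measurable (M \<Otimes>\<^sub>M count_space S)"
proof -
  have "(\<lambda>(y, x). F x y) \<in> borel_measurable (count_space S \<Otimes>\<^sub>M M)"
    using assms by (intro measurable_pair_measure_countable1) auto
  then show ?thesis
    by (subst measurable_pair_swap_iff) (simp add: split_def)
qed

text \<open>In the closed left half plane the exponentials have modulus at most 1 for s > 0, so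
  |f(s)| |w(\<eta>)| dominates. Every exchange of a single sum with an integral below is an
  instance, with f an exponential or a section of \<open>Kv\<close>.\<close>

lemma integral_exp_sum_mult:
  fixes w :: "complex \<Rightarrow> complex" and f :: "real \<Rightarrow> complex"
  assumes S: "countable S" and w: "integrable (count_space S) w"
    and Re: "\<And>\<eta>. \<eta> \<in> S \<Longrightarrow> Re \<eta> \<le> 0" and f: "integrable half_line f"
  shows "(LINT s|half_line. (LINT \<eta>|count_space S. w \<eta> * exp (complex_of_real s * \<eta>)) * f s) =
    (LINT \<eta>|count_space S. w \<eta> * (LINT s|half_line. exp (complex_of_real s * \<eta>) * f s))"
proof -
  have e: "(\<lambda>s. exp (complex_of_real s * \<eta>)) \<in> borel_measurable half_line" for \<eta>
    by (rule borel_measurable_half_lineI) measurable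
  have "(LINT s|half_line. LINT \<eta>|count_space S. w \<eta> * exp (complex_of_real s * \<eta>) * f s) =
    (LINT \<eta>|count_space S. LINT s|half_line. w \<eta> * exp (complex_of_real s * \<eta>) * f s)"
  proof (rule integral_swap_of_bound(2)[OF sigma_finite_half_line sigma_finite_measure_count_space_countable[OF S]])
    show "(\<lambda>(s, \<eta>). w \<eta> * exp (complex_of_real s * \<eta>) * f s) \<in>
        borel_measurable (half_line \<Otimes>\<^sub>M count_space S)"
      using f by (intro borel_measurable_pair_count_space S borel_measurable_times e) auto
    show "integrable half_line (\<lambda>s. cmod (f s))" "integrable (count_space S) (\<lambda>\<eta>. cmod (w \<eta>))"
      using w f by auto
    fix s \<eta> assume "s \<in> space half_line" "\<eta> \<in> space (count_space S)"
    then have "exp (s * Re \<eta>) \<le> 1"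
      using Re[of \<eta>] by (simp add: mult_nonneg_nonpos)
    then have "cmod (f s) * cmod (w \<eta>) * exp (s * Re \<eta>) \<le> cmod (f s) * cmod (w \<eta>) * 1"
      by (intro mult_left_mono) auto
    then show "cmod (w \<eta> * exp (complex_of_real s * \<eta>) * f s) \<le> cmod (f s) * cmod (w \<eta>)"
      by (simp add: norm_mult mult_ac)
  qed
  moreover have "(LINT s|half_line. w \<eta> * exp (complex_of_real s * \<eta>) * f s) =
      w \<eta> * (LINT s|half_line. exp (complex_of_real s * \<eta>) * f s)" for \<eta>
    unfolding mult.assoc by simp
  ultimately show ?thesis by simp
qed

text \<open>The distance \<delta> of the points from the imaginary axis becomes a common decay rate;
  the weights enter only through their l1 norm.\<close>

lemma norm_exp_sum_le:
  fixes w :: "complex \<Rightarrow> complex"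
  assumes w: "integrable (count_space S) w" and Re: "\<And>\<eta>. \<eta> \<in> S \<Longrightarrow> Re \<eta> \<le> - \<delta>" and "0 \<le> s"
  shows "integrable (count_space S) (\<lambda>\<eta>. w \<eta> * exp (complex_of_real s * \<eta>))"
    and "cmod (LINT \<eta>|count_space S. w \<eta> * exp (complex_of_real s * \<eta>)) \<le>
      (LINT \<eta>|count_space S. cmod (w \<eta>)) * exp (- \<delta> * s)"
proof -
  have le: "cmod (w \<eta> * exp (complex_of_real s * \<eta>)) \<le> cmod (w \<eta>) * exp (- \<delta> * s)"
    if "\<eta> \<in> S" for \<eta>
    using mult_left_mono[OF Re[OF that] \<open>0 \<le> s\<close>]
    by (auto simp: norm_mult mult.commute[of s] intro!: mult_left_mono)
  have int': "integrable (count_space S) (\<lambda>\<eta>. cmod (w \<eta>) * exp (- \<delta> * s))"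
    using w by simp
  show int: "integrable (count_space S) (\<lambda>\<eta>. w \<eta> * exp (complex_of_real s * \<eta>))"
    by (rule Bochner_Integration.integrable_bound[OF int']) (use le in \<open>auto intro!: AE_I2\<close>)
  have "cmod (LINT \<eta>|count_space S. w \<eta> * exp (complex_of_real s * \<eta>)) \<le>
      (LINT \<eta>|count_space S. cmod (w \<eta>) * exp (- \<delta> * s))"
    by (rule order_trans[OF integral_norm_bound])
      (intro integral_mono integrable_norm int int', use le in auto)
  then show "cmod (LINT \<eta>|count_space S. w \<eta> * exp (complex_of_real s * \<eta>)) \<le>
      (LINT \<eta>|count_space S. cmod (w \<eta>)) * exp (- \<delta> * s)"
    by simp
qed


text \<open>Everything the two kernels require of the set and the weights, freed from the
  polylogarithm. Here p is an arbitrary square root of the weight of \<open>Ku\<close>; replacing it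
  by another one conjugates K by signs.\<close>

theorem fredholm_det_exp_sums:
  fixes e :: "nat \<Rightarrow> complex" and p v :: "complex \<Rightarrow> complex"
  assumes e: "bij_betw e UNIV S" and \<delta>: "0 < \<delta>"
    and Re: "\<And>\<xi>. \<xi> \<in> S \<Longrightarrow> Re \<xi> \<le> - \<delta>"
    and p_le: "\<And>k. (cmod (p (e k)))\<^sup>2 \<le> C / 4 ^ k"
    and v_le: "\<And>k. cmod (v (e k)) \<le> C / 4 ^ k"
    and Ku_infsum: "\<And>s t. 0 < s \<Longrightarrow> 0 < t \<Longrightarrow>
      Ku s t = (\<Sum>\<^sub>\<infinity>\<xi>\<in>S. (p \<xi>)\<^sup>2 * exp (complex_of_real (s + t) * \<xi>))"
    and Kv_infsum: "\<And>s t. 0 < s \<Longrightarrow> 0 < t \<Longrightarrow>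
      Kv s t = (\<Sum>\<^sub>\<infinity>\<xi>\<in>S. v \<xi> * exp (complex_of_real (s + t) * \<xi>))"
    and K_infsum: "\<And>\<xi> \<xi>'. \<xi> \<in> S \<Longrightarrow> \<xi>' \<in> S \<Longrightarrow>
      K \<xi> \<xi>' = (\<Sum>\<^sub>\<infinity>\<eta>\<in>S. p \<xi> * v \<eta> * p \<xi>' / ((\<xi> + \<eta>) * (\<eta> + \<xi>')))"
  shows "trace_class_kernel half_line Ku"
    and "\<exists>D. has_fredholm_det (count_space S) K D \<and>
      has_fredholm_det half_line (kernel_comp half_line Kv Ku) D"
proof -
  let ?N = "count_space S"
  let ?H = half_line
  have S: "countable S"
    using bij_betw_imp_surj_on[OF e] by (metis countable_image countableI_type)
  have eS: "e k \<in> S" for k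
    using bij_betwE[OF e] by auto
  have C0: "0 \<le> C"
    using order_trans[OF norm_ge_zero v_le[of 0]] by simp
  have Re0: "\<xi> \<in> S \<Longrightarrow> Re \<xi> \<le> 0" for \<xi>
    using Re[of \<xi>] \<delta> by simp
  have summ: "summable (\<lambda>k. C / 4 ^ k)"
    using summable_mult[OF summable_geometric[of "1/4::real"], of C] by (simp add: power_divide)
  have int_le: "integrable ?N f" if "\<And>k. cmod (f (e k)) \<le> C / 4 ^ k" for f :: "complex \<Rightarrow> complex"
    using that summable_comparison_test'[OF summ, of 0 "\<lambda>k. cmod (f (e k))"]
    by (simp add: integrable_count_space_nat_iff flip: integrable_bij_count_space[OF e])
  have int_p: "integrable ?N (\<lambda>\<xi>. (p \<xi>)\<^sup>2)" and int_v: "integrable ?N v"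
    using p_le v_le by (auto intro!: int_le simp: norm_power)
  have int_p': "integrable ?N (\<lambda>\<xi>. cmod (p \<xi>) * cmod (p \<xi>))"
    using integrable_norm[OF int_p] by (simp add: norm_mult power2_eq_square)
  define V where "V = (LINT \<eta>|?N. cmod (v \<eta>))"
  have V0: "0 \<le> V"
    by (simp add: V_def)
  \<comment> \<open>Negative real parts add without cancellation, also for coinciding
    points.\<close>
  have nz: "2 * \<delta> \<le> cmod (\<xi> + \<eta>)" "Re (\<xi> + \<eta>) < 0" if "\<xi> \<in> S" "\<eta> \<in> S" for \<xi> \<eta>
    using abs_Re_le_cmod[of "\<xi> + \<eta>"] Re[OF that(1)] Re[OF that(2)] \<delta> by auto
  have exp_meas: "(\<lambda>s. exp (complex_of_real s * \<xi>)) \<in> borel_measurable ?H" for \<xi>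
    by (rule borel_measurable_half_lineI) measurable
  have exp_int: "integrable ?H (\<lambda>s. exp (complex_of_real s * \<xi>))" if "\<xi> \<in> S" for \<xi>
    using Re[OF that] \<delta> by (intro exp_half_line) simp
  have exp_prod: "(LINT s|?H. exp (complex_of_real s * \<xi>) * exp (complex_of_real s * \<eta>)) = - 1 / (\<xi> + \<eta>)"
    if "\<xi> \<in> S" "\<eta> \<in> S" for \<xi> \<eta>
    using exp_half_line(2)[OF nz(2)[OF that]] by (simp add: distrib_left exp_add)
  have exp_norm: "cmod (exp (complex_of_real s * \<xi>)) \<le> exp (- \<delta> * s)" if "0 < s" "\<xi> \<in> S" for s \<xi>
    using mult_left_mono[OF Re[OF that(2)], of s] that(1) by (simp add: mult.commute[of s])
  have exp_int_real: "integrable ?H (\<lambda>s. exp (- \<delta> * s))"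
    by (rule exp_real_half_line[OF \<delta>])
  interpret N: sigma_finite_measure ?N
    by (rule sigma_finite_measure_count_space_countable[OF S])

  have wint: "integrable ?N (\<lambda>\<xi>. w \<xi> * exp (complex_of_real t * \<xi>))"
    if "integrable ?N w" "0 < t" for w t
    using that by (intro norm_exp_sum_le[OF _ Re]) auto
  have Ku: "Ku s t = (LINT \<xi>|?N. (p \<xi>)\<^sup>2 * exp (complex_of_real (s + t) * \<xi>))" if "0 < s" "0 < t" for s t
    unfolding Ku_infsum[OF that] using that by (intro infsum_eq_lebesgue_count_space wint int_p) simp
  have Kv: "Kv s t = (LINT \<xi>|?N. v \<xi> * exp (complex_of_real (s + t) * \<xi>))" if "0 < s" "0 < t" for s t
    unfolding Kv_infsum[OF that] using that by (intro infsum_eq_lebesgue_count_space wint int_v) simp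

  \<comment> \<open>Because exp((s + t) \<xi>) separates, the defining sum is already an expansion
    into rank-one kernels. The tail of the geometric series from index n is its total divided by
    4^n, whence \<open>r\<close>.\<close>
  show "trace_class_kernel ?H Ku"
  proof (rule trace_class_kernel_of_expansion[OF sigma_finite_half_line,
        where h = "\<lambda>s. exp (- \<delta> * s)" and \<phi> = "\<lambda>k s. exp (complex_of_real s * e k)"
          and u = "\<lambda>k. (p (e k))\<^sup>2" and r = "\<lambda>n. (\<Sum>k. C / 4 ^ k) / 4 ^ n"])
    let ?t = "\<lambda>z \<xi>. (p \<xi>)\<^sup>2 * (exp (complex_of_real (fst z) * \<xi>) * exp (complex_of_real (snd z) * \<xi>))"
    have "(\<lambda>(z, \<xi>). ?t z \<xi>) \<in> borel_measurable ((?H \<Otimes>\<^sub>M ?H) \<Otimes>\<^sub>M ?N)"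
      by (intro borel_measurable_pair_count_space S borel_measurable_times borel_measurable_const
          measurable_compose[OF measurable_fst exp_meas] measurable_compose[OF measurable_snd exp_meas])
    then have "(\<lambda>z. LINT \<xi>|?N. ?t z \<xi>) \<in> borel_measurable (?H \<Otimes>\<^sub>M ?H)"
      by (rule N.borel_measurable_lebesgue_integral)
    also have "?this \<longleftrightarrow> case_prod Ku \<in> borel_measurable (?H \<Otimes>\<^sub>M ?H)"
      by (intro measurable_cong) (auto simp: space_pair_measure Ku distrib_left distrib_right exp_add)
    finally show "case_prod Ku \<in> borel_measurable (?H \<Otimes>\<^sub>M ?H)" .
  next
    show "(\<lambda>s. exp (- \<delta> * s)) \<in> borel_measurable ?H"
      by (rule borel_measurable_half_lineI) measurable
    have "(exp (- \<delta> * s))\<^sup>2 = exp (- (2 * \<delta>) * s)" for s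
      by (simp add: power2_eq_square mult_exp_exp)
    then show "integrable ?H (\<lambda>s. (exp (- \<delta> * s))\<^sup>2)"
      using exp_real_half_line[of "2 * \<delta>"] \<delta> by simp
    show "summable (\<lambda>n. (\<Sum>k. C / 4 ^ k) / 4 ^ n)"
      using summable_mult[OF summable_geometric[of "1/4::real"]] by (simp add: power_divide)
    show "0 \<le> (\<Sum>k. C / 4 ^ k) / 4 ^ n" for n
      using C0 by (intro divide_nonneg_nonneg suminf_nonneg summ) auto
    fix n and s t :: real assume "s \<in> space ?H" "t \<in> space ?H"
    then have st: "0 < s" "0 < t" by auto
    define a where "a k = (p (e k))\<^sup>2 * exp (complex_of_real s * e k) * exp (complex_of_real t * e k)" for k
    have a_le: "cmod (a k) \<le> C / 4 ^ k * exp (- \<delta> * s) * exp (- \<delta> * t)" for k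
      unfolding a_def norm_mult norm_power
      by (intro mult_mono p_le exp_norm st eS mult_nonneg_nonneg) (use C0 in auto)
    have a_summ: "summable a"
      by (rule summable_comparison_test'[OF _ a_le])
        (intro summable_mult2 summ)
    have "integrable ?N (\<lambda>\<xi>. (p \<xi>)\<^sup>2 * exp (complex_of_real (s + t) * \<xi>))"
      using st by (intro wint int_p) simp
    then have "Ku s t = (LINT k|count_space UNIV. a k)" "integrable (count_space UNIV) a"
      using Ku[OF st] by (simp_all add: a_def[abs_def] exp_add distrib_right mult.assoc
          flip: integral_bij_count_space[OF e] integrable_bij_count_space[OF e])
    then have Ku_eq: "Ku s t = suminf a"
      by (simp add: integral_count_space_nat)
    have "cmod (Ku s t - (\<Sum>k<n. a k)) = cmod (\<Sum>k. a (k + n))"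
      by (simp add: Ku_eq suminf_minus_initial_segment[OF a_summ])
    also have "\<dots> \<le> (\<Sum>k. C / 4 ^ k * (exp (- \<delta> * s) * exp (- \<delta> * t) / 4 ^ n))"
      using a_le[of "_ + n"] by (intro norm_suminf_le summable_mult2 summ) (simp add: power_add mult_ac)
    also have "\<dots> = (\<Sum>k. C / 4 ^ k) / 4 ^ n * exp (- \<delta> * s) * exp (- \<delta> * t)"
      by (subst suminf_mult2[OF summ, symmetric]) simp
    finally show "cmod (Ku s t - (\<Sum>k<n. (p (e k))\<^sup>2 * exp (complex_of_real s * e k) * exp (complex_of_real t * e k)))
        \<le> (\<Sum>k. C / 4 ^ k) / 4 ^ n * exp (- \<delta> * s) * exp (- \<delta> * t)"
      by (simp add: a_def)
  qed (use exp_meas exp_norm eS in auto)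

  have frac_le: "cmod (x / (\<xi> + \<eta>)) \<le> cmod x / (2 * \<delta>)" if "\<xi> \<in> S" "\<eta> \<in> S" for x \<xi> \<eta>
    using nz(1)[OF that] \<delta> by (simp add: norm_divide frac_le)
  have int_frac: "integrable ?N (\<lambda>\<eta>. f \<eta> / (\<eta> + \<xi>))" if "integrable ?N f" "\<xi> \<in> S" for f \<xi>
  proof (rule Bochner_Integration.integrable_bound)
    show "integrable ?N (\<lambda>\<eta>. cmod (f \<eta>) / (2 * \<delta>))"
      using that by simp
    show "AE \<eta> in ?N. norm (f \<eta> / (\<eta> + \<xi>)) \<le> norm (cmod (f \<eta>) / (2 * \<delta>))"
      using frac_le that(2) \<delta> by (intro AE_I2) simp
  qed simp
  have norm_frac: "(LINT \<eta>|?N. cmod (f \<eta> / (\<eta> + \<xi>))) \<le> (LINT \<eta>|?N. cmod (f \<eta>)) / (2 * \<delta>)"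
    if "integrable ?N f" "\<xi> \<in> S" for f \<xi>
  proof -
    have "(LINT \<eta>|?N. cmod (f \<eta> / (\<eta> + \<xi>))) \<le> (LINT \<eta>|?N. cmod (f \<eta>) / (2 * \<delta>))"
      using that by (intro integral_mono integrable_norm int_frac frac_le) auto
    then show ?thesis by simp
  qed

  have K: "K \<xi> \<xi>' = p \<xi> * p \<xi>' * (LINT \<eta>|?N. v \<eta> / (\<eta> + \<xi>) / (\<eta> + \<xi>'))"
    if "\<xi> \<in> S" "\<xi>' \<in> S" for \<xi> \<xi>'
  proof -
    have eq: "p \<xi> * v \<eta> * p \<xi>' / ((\<xi> + \<eta>) * (\<eta> + \<xi>')) = p \<xi> * p \<xi>' * (v \<eta> / (\<eta> + \<xi>) / (\<eta> + \<xi>'))" for \<eta>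
      by (simp add: mult_ac add.commute)
    have "integrable ?N (\<lambda>\<eta>. p \<xi> * p \<xi>' * (v \<eta> / (\<eta> + \<xi>) / (\<eta> + \<xi>')))"
      by (intro integrable_mult_right int_frac int_v that)
    from infsum_eq_lebesgue_count_space[OF this] show ?thesis
      unfolding K_infsum[OF that] eq by (simp only: integral_mult_right_zero)
  qed
  \<comment> \<open>V is split as sqrt V times sqrt V to give the bound the symmetric form q(\<xi>)
    q(\<xi>') that the existence of the determinant asks for.\<close>
  have K_le: "cmod (K \<xi> \<xi>') \<le> (sqrt V / (2 * \<delta>) * cmod (p \<xi>)) * (sqrt V / (2 * \<delta>) * cmod (p \<xi>'))"
    if "\<xi> \<in> S" "\<xi>' \<in> S" for \<xi> \<xi>'
  proof -
    have "cmod (K \<xi> \<xi>') \<le> cmod (p \<xi>) * cmod (p \<xi>') * cmod (LINT \<eta>|?N. v \<eta> / (\<eta> + \<xi>) / (\<eta> + \<xi>'))"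
      by (simp add: K[OF that] norm_mult)
    also have "\<dots> \<le> cmod (p \<xi>) * cmod (p \<xi>') * (V / (2 * \<delta>) / (2 * \<delta>))"
    proof (intro mult_left_mono mult_nonneg_nonneg norm_ge_zero)
      have "cmod (LINT \<eta>|?N. v \<eta> / (\<eta> + \<xi>) / (\<eta> + \<xi>')) \<le> (LINT \<eta>|?N. cmod (v \<eta> / (\<eta> + \<xi>) / (\<eta> + \<xi>')))"
        by (rule integral_norm_bound)
      also have "\<dots> \<le> (LINT \<eta>|?N. cmod (v \<eta> / (\<eta> + \<xi>))) / (2 * \<delta>)"
        by (intro norm_frac int_frac int_v that)
      also have "\<dots> \<le> V / (2 * \<delta>) / (2 * \<delta>)"
        unfolding V_def using \<delta> by (intro divide_right_mono norm_frac int_v that) auto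
      finally show "cmod (LINT \<eta>|?N. v \<eta> / (\<eta> + \<xi>) / (\<eta> + \<xi>')) \<le> V / (2 * \<delta>) / (2 * \<delta>)" .
    qed
    also have "V = sqrt V * sqrt V"
      using V0 by simp
    also have "cmod (p \<xi>) * cmod (p \<xi>') * (sqrt V * sqrt V / (2 * \<delta>) / (2 * \<delta>)) =
        (sqrt V / (2 * \<delta>) * cmod (p \<xi>)) * (sqrt V / (2 * \<delta>) * cmod (p \<xi>'))"
      by simp
    finally show ?thesis .
  qed
  have q_le: "(sqrt V / (2 * \<delta>) * cmod (p (e k)))\<^sup>2 \<le> V / (2 * \<delta>)\<^sup>2 * C / 4 ^ k" for k
    using mult_left_mono[OF p_le[of k], of "V / (2 * \<delta>)\<^sup>2"] V0 by (simp add: power_mult_distrib power_divide)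
  obtain D where D: "has_fredholm_det ?N K D"
    using has_fredholm_det_count_space_exists[OF e K_le q_le] by blast

  \<comment> \<open>A(s, \<xi>) is the integral of \<open>Kv s u * B \<xi> u\<close> over u in
    closed form, the factor -1/(\<eta> + \<xi>) being that of two multiplied exponentials.\<close>
  define A where "A s \<xi> = p \<xi> * (LINT \<eta>|?N. - (v \<eta> / (\<eta> + \<xi>)) * exp (complex_of_real s * \<eta>))" for s \<xi>
  define B where "B \<xi> s = p \<xi> * exp (complex_of_real s * \<xi>)" for \<xi> s
  have "has_fredholm_det ?H (kernel_comp ?H Kv Ku) D"
  proof (rule has_fredholm_det_commute[OF sigma_finite_half_line N.sigma_finite_measure_axioms _ _ _ _ _ _ _ _ D,
        where A = A and B = B and g = "\<lambda>\<xi>. cmod (p \<xi>)" and g' = "\<lambda>\<xi>. cmod (p \<xi>)"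
        and f = "\<lambda>s. V / (2 * \<delta>) * exp (- \<delta> * s)" and f' = "\<lambda>s. exp (- \<delta> * s)"])
    show "(\<lambda>(s, \<xi>). A s \<xi>) \<in> borel_measurable (?H \<Otimes>\<^sub>M ?N)"
    proof (rule borel_measurable_pair_count_space[OF S])
      fix \<xi>
      have "(\<lambda>s. LINT \<eta>|?N. - (v \<eta> / (\<eta> + \<xi>)) * exp (complex_of_real s * \<eta>)) \<in> borel_measurable ?H"
        by (intro N.borel_measurable_lebesgue_integral borel_measurable_pair_count_space S
            borel_measurable_times borel_measurable_const exp_meas)
      then show "(\<lambda>s. A s \<xi>) \<in> borel_measurable ?H"
        unfolding A_def by (intro borel_measurable_times borel_measurable_const)
    qed
    show "(\<lambda>(s, \<xi>). B \<xi> s) \<in> borel_measurable (?H \<Otimes>\<^sub>M ?N)"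
      unfolding B_def
      by (intro borel_measurable_pair_count_space S borel_measurable_times borel_measurable_const exp_meas)
    show "cmod (B \<xi> s) \<le> exp (- \<delta> * s) * cmod (p \<xi>)" if "s \<in> space ?H" "\<xi> \<in> space ?N" for s \<xi>
      using mult_left_mono[OF exp_norm[of s \<xi>], of "cmod (p \<xi>)"] that
      by (simp add: B_def norm_mult mult.commute)
    show "cmod (A s \<xi>) \<le> V / (2 * \<delta>) * exp (- \<delta> * s) * cmod (p \<xi>)"
      if "s \<in> space ?H" "\<xi> \<in> space ?N" for s \<xi>
    proof -
      have "cmod (LINT \<eta>|?N. - (v \<eta> / (\<eta> + \<xi>)) * exp (complex_of_real s * \<eta>)) \<le>
          (LINT \<eta>|?N. cmod (- (v \<eta> / (\<eta> + \<xi>)))) * exp (- \<delta> * s)"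
        using that by (intro norm_exp_sum_le Re integrable_minus int_frac int_v) auto
      also have "\<dots> \<le> V / (2 * \<delta>) * exp (- \<delta> * s)"
        using norm_frac[OF int_v, of \<xi>] that by (intro mult_right_mono) (simp_all add: V_def)
      finally have "cmod (p \<xi>) * cmod (LINT \<eta>|?N. - (v \<eta> / (\<eta> + \<xi>)) * exp (complex_of_real s * \<eta>)) \<le>
          cmod (p \<xi>) * (V / (2 * \<delta>) * exp (- \<delta> * s))"
        by (intro mult_left_mono) auto
      then show ?thesis
        by (simp only: A_def norm_mult mult_ac)
    qed
    have "exp (- \<delta> * s) * exp (- \<delta> * s) = exp (- (2 * \<delta>) * s)" for s
      by (simp add: mult_exp_exp)
    then show "integrable ?H (\<lambda>s. V / (2 * \<delta>) * exp (- \<delta> * s) * exp (- \<delta> * s))"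
      unfolding mult.assoc[of "V / (2 * \<delta>)"]
      using exp_real_half_line[of "2 * \<delta>"] \<delta> by (intro integrable_mult_right) simp
    show "integrable ?N (\<lambda>\<xi>. cmod (p \<xi>) * cmod (p \<xi>))"
      by (rule int_p')
  next
    fix \<xi> \<xi>' assume "\<xi> \<in> space ?N" "\<xi>' \<in> space ?N"
    then have \<xi>: "\<xi> \<in> S" "\<xi>' \<in> S" by auto
    \<comment> \<open>One denominator of K is already in A, the other arises from integrating the
      two exponentials in s; their minus signs cancel.\<close>
    have "(LINT s|?H. B \<xi> s * A s \<xi>') = (LINT s|?H. p \<xi> * p \<xi>' *
      ((LINT \<eta>|?N. - (v \<eta> / (\<eta> + \<xi>')) * exp (complex_of_real s * \<eta>)) * exp (complex_of_real s * \<xi>)))"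
      unfolding A_def B_def by (simp only: mult_ac)
    also have "\<dots> = p \<xi> * p \<xi>' *
      (LINT s|?H. (LINT \<eta>|?N. - (v \<eta> / (\<eta> + \<xi>')) * exp (complex_of_real s * \<eta>)) * exp (complex_of_real s * \<xi>))"
      by (rule integral_mult_right_zero)
    also have "\<dots> = p \<xi> * p \<xi>' *
        (LINT \<eta>|?N. - (v \<eta> / (\<eta> + \<xi>')) * (LINT s|?H. exp (complex_of_real s * \<eta>) * exp (complex_of_real s * \<xi>)))"
      using \<xi> by (subst integral_exp_sum_mult) (auto intro!: S Re0 integrable_minus int_frac int_v exp_int)
    also have "\<dots> = K \<xi> \<xi>'"
      unfolding K[OF \<xi>]
      by (intro arg_cong2[of _ _ _ _ "(*)"] refl Bochner_Integration.integral_cong) (simp add: exp_prod \<xi>)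
    finally show "K \<xi> \<xi>' = (LINT s|?H. B \<xi> s * A s \<xi>')" ..
  next
    fix s t assume "s \<in> space ?H" "t \<in> space ?H"
    then have st: "0 < s" "0 < t" by auto
    have Kvs: "Kv s u = (LINT \<eta>|?N. v \<eta> * exp (complex_of_real s * \<eta>) * exp (complex_of_real u * \<eta>))"
      if "0 < u" for u
      using Kv[OF st(1) that] by (simp add: exp_add distrib_right mult.assoc)
    have Kut: "Ku u t = (LINT \<xi>|?N. (p \<xi>)\<^sup>2 * exp (complex_of_real t * \<xi>) * exp (complex_of_real u * \<xi>))"
      if "0 < u" for u
      using Ku[OF that st(2)] by (simp only: add.commute[of u t] of_real_add distrib_right exp_add mult.assoc)
    \<comment> \<open>Allows the sum in \<open>Ku\<close> to be taken out with \<open>Kv s\<close>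
      kept as one integrable function; the sum in \<open>Kv\<close> follows separately, so no double
      sum has to be exchanged with the integral.\<close>
    have Kv_int: "integrable ?H (Kv s)"
    proof (rule Bochner_Integration.integrable_bound)
      show "integrable ?H (\<lambda>u. (LINT \<eta>|?N. cmod (v \<eta> * exp (complex_of_real s * \<eta>))) * exp (- \<delta> * u))"
        using exp_int_real by simp
      have "(\<lambda>u. LINT \<eta>|?N. v \<eta> * exp (complex_of_real s * \<eta>) * exp (complex_of_real u * \<eta>)) \<in> borel_measurable ?H"
        by (intro N.borel_measurable_lebesgue_integral borel_measurable_pair_count_space S
            borel_measurable_times borel_measurable_const exp_meas)
      also have "?this \<longleftrightarrow> Kv s \<in> borel_measurable ?H"
        by (intro measurable_cong) (simp add: Kvs)
      finally show "Kv s \<in> borel_measurable ?H" .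
      show "AE u in ?H. norm (Kv s u) \<le>
          norm ((LINT \<eta>|?N. cmod (v \<eta> * exp (complex_of_real s * \<eta>))) * exp (- \<delta> * u))"
      proof (intro AE_I2)
        fix u assume "u \<in> space ?H"
        then have u: "0 < u" by simp
        show "norm (Kv s u) \<le>
            norm ((LINT \<eta>|?N. cmod (v \<eta> * exp (complex_of_real s * \<eta>))) * exp (- \<delta> * u))"
          unfolding Kvs[OF u] real_norm_def
          by (rule order_trans[OF norm_exp_sum_le(2)[OF wint[OF int_v st(1)] Re less_imp_le[OF u]] abs_ge_self])
      qed
    qed
    have "kernel_comp ?H Kv Ku s t = (LINT u|?H.
        (LINT \<xi>|?N. (p \<xi>)\<^sup>2 * exp (complex_of_real t * \<xi>) * exp (complex_of_real u * \<xi>)) * Kv s u)"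
      unfolding kernel_comp_def
      by (intro Bochner_Integration.integral_cong refl) (simp add: Kut mult.commute)
    also have "\<dots> = (LINT \<xi>|?N. (p \<xi>)\<^sup>2 * exp (complex_of_real t * \<xi>) *
        (LINT u|?H. exp (complex_of_real u * \<xi>) * Kv s u))"
      by (intro integral_exp_sum_mult S wint int_p st Re0 Kv_int)
    also have "\<dots> = (LINT \<xi>|?N. A s \<xi> * B \<xi> t)"
    proof (intro Bochner_Integration.integral_cong refl)
      fix \<xi> assume "\<xi> \<in> space ?N"
      then have \<xi>: "\<xi> \<in> S" by simp
      have "(LINT u|?H. exp (complex_of_real u * \<xi>) * Kv s u) = (LINT u|?H.
          (LINT \<eta>|?N. v \<eta> * exp (complex_of_real s * \<eta>) * exp (complex_of_real u * \<eta>)) * exp (complex_of_real u * \<xi>))"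
        by (intro Bochner_Integration.integral_cong refl) (simp add: Kvs mult.commute)
      also have "\<dots> = (LINT \<eta>|?N. v \<eta> * exp (complex_of_real s * \<eta>) *
          (LINT u|?H. exp (complex_of_real u * \<eta>) * exp (complex_of_real u * \<xi>)))"
        by (intro integral_exp_sum_mult S wint int_v st Re0 exp_int \<xi>)
      also have "\<dots> = (LINT \<eta>|?N. - (v \<eta> / (\<eta> + \<xi>)) * exp (complex_of_real s * \<eta>))"
        by (intro Bochner_Integration.integral_cong refl) (simp add: exp_prod \<xi>)
      finally show "(p \<xi>)\<^sup>2 * exp (complex_of_real t * \<xi>) *
          (LINT u|?H. exp (complex_of_real u * \<xi>) * Kv s u) = A s \<xi> * B \<xi> t"
        by (simp only: A_def B_def power2_eq_square mult_ac)
    qed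
    finally show "kernel_comp ?H Kv Ku s t = (LINT \<xi>|?N. A s \<xi> * B \<xi> t)" .
  qed
  with D show "\<exists>D. has_fredholm_det ?N K D \<and> has_fredholm_det ?H (kernel_comp ?H Kv Ku) D"
    by blast
qed


section \<open>The points of S_minus\<close>

text \<open>Moduli in exp(-\<xi>^2/2) = z determine Re(\<xi>^2): the set lies on the left branch of
  a hyperbola.\<close>

lemma S_minus_real_parts:
  assumes "\<xi> \<in> S_minus z"
  shows "Re \<xi> < 0" "(Re \<xi>)\<^sup>2 - (Im \<xi>)\<^sup>2 = - 2 * ln (cmod z)"
proof -
  have "z = exp (- \<xi>\<^sup>2 / 2)" and "Re \<xi> < 0"
    using assms by (auto simp: S_minus_def)
  then show "Re \<xi> < 0" "(Re \<xi>)\<^sup>2 - (Im \<xi>)\<^sup>2 = - 2 * ln (cmod z)"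
    by (simp_all add: Re_power2 field_simps)
qed

text \<open>The right-hand side is the vertex of the hyperbola; its absolute value is the \<delta>
  of the general theorem.\<close>

lemma Re_le_S_minus:
  assumes "\<xi> \<in> S_minus z"
  shows "Re \<xi> \<le> - sqrt (- 2 * ln (cmod z))"
proof -
  have "- 2 * ln (cmod z) \<le> (- Re \<xi>)\<^sup>2"
    using S_minus_real_parts(2)[OF assms] zero_le_power2[of "Im \<xi>"]
    unfolding power2_minus by linarith
  then have "sqrt (- 2 * ln (cmod z)) \<le> - Re \<xi>"
    using S_minus_real_parts(1)[OF assms] by (intro real_le_lsqrt) auto
  then show ?thesis by simp
qed

text \<open>The integer \<open>int_decode n\<close> numbers the branches of the logarithm in \<xi>^2
  = -2 (Ln z + 2 pi i k), and minus the principal root selects the left half plane.\<close>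

definition S_minus_enum :: "complex \<Rightarrow> nat \<Rightarrow> complex" where
  "S_minus_enum z n = - csqrt (- 2 * Ln z - 4 * of_real pi * \<i> * of_int (int_decode n))"

lemma S_minus_enum_square:
  "(S_minus_enum z n)\<^sup>2 = - 2 * Ln z - 4 * of_real pi * \<i> * of_int (int_decode n)"
  by (simp add: S_minus_enum_def)

lemma Re_csqrt_pos:
  assumes "0 < Re w"
  shows "0 < Re (csqrt w)"
proof -
  have "Re (csqrt w) \<noteq> 0"
  proof
    assume "Re (csqrt w) = 0"
    then have "Re ((csqrt w)\<^sup>2) \<le> 0" by (simp add: Re_power2 del: power2_csqrt)
    then show False using assms by simp
  qed
  then show ?thesis
    using csqrt_principal[of w] by auto
qed

lemma bij_betw_S_minus_enum:
  assumes "0 < cmod z" "cmod z < 1"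
  shows "bij_betw (S_minus_enum z) UNIV (S_minus z)"
  unfolding bij_betw_def
proof (intro conjI subset_antisym subsetI)
  show "inj (S_minus_enum z)"
  proof (rule injI)
    fix m n assume "S_minus_enum z m = S_minus_enum z n"
    then have "(S_minus_enum z m)\<^sup>2 = (S_minus_enum z n)\<^sup>2" by simp
    then have "of_int (int_decode m) = (of_int (int_decode n) :: complex)"
      unfolding S_minus_enum_square by simp
    then show "m = n"
      using inj_int_decode[of UNIV] by (auto dest: injD)
  qed
  have z: "z \<noteq> 0" using assms by auto
  have lnz: "ln (cmod z) < 0" using assms by simp
  show "\<xi> \<in> S_minus z" if range: "\<xi> \<in> range (S_minus_enum z)" for \<xi>
  proof -
    from range obtain n where n: "\<xi> = S_minus_enum z n" by auto
    have "- \<xi>\<^sup>2 / 2 = Ln z + of_int (2 * int_decode n) * (of_real pi * \<i>)"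
      unfolding n S_minus_enum_square by simp
    then have "exp (- \<xi>\<^sup>2 / 2) = z"
      using z by (simp add: exp_add exp_eq_1 mult.commute)
    moreover have "Re \<xi> < 0"
      using Re_csqrt_pos[of "- 2 * Ln z - 4 * of_real pi * \<i> * of_int (int_decode n)"] lnz z
      by (simp add: n S_minus_enum_def)
    ultimately show ?thesis by (simp add: S_minus_def)
  qed
  show "\<xi> \<in> range (S_minus_enum z)" if \<xi>: "\<xi> \<in> S_minus z" for \<xi>
  proof -
    have "exp (- \<xi>\<^sup>2 / 2) = exp (Ln z)"
      using \<xi> z by (simp add: S_minus_def)
    then obtain k :: int where "- \<xi>\<^sup>2 / 2 = Ln z + of_int (2 * k) * of_real pi * \<i>"
      unfolding exp_eq by auto
    then have "- 2 * (- \<xi>\<^sup>2 / 2) = - 2 * Ln z - 4 * of_real pi * \<i> * of_int k"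
      by (simp only:) (simp add: algebra_simps)
    then have "\<xi>\<^sup>2 = - 2 * Ln z - 4 * of_real pi * \<i> * of_int k"
      by simp
    \<comment> \<open>\<open>- \<xi>\<close> lies in the right half plane, where the principal root
      inverts squaring.\<close>
    moreover have "csqrt (\<xi>\<^sup>2) = - \<xi>"
      using csqrt_square[of "- \<xi>"] \<xi> by (simp add: S_minus_def)
    ultimately have "\<xi> = S_minus_enum z (int_encode k)"
      by (simp add: S_minus_enum_def)
    then show ?thesis by simp
  qed
qed

text \<open>The indices 2k and 2k + 1 decode to k and -k - 1.\<close>

lemma le_abs_int_decode: "int n \<le> 2 * \<bar>int_decode n\<bar>"
  unfolding int_decode_def sum_decode_def by (auto elim!: evenE oddE)

text \<open>The branch number is controlled by |\<xi>|^2, and |\<xi>|^2 is at most 2 (Re \<xi>)^2 on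
  the hyperbola. So (Re \<xi>)^2 grows at least linearly in the index, and its cube-root-free power
  |Re \<xi>|^3 faster than linearly.\<close>

lemma index_le_S_minus_enum:
  assumes "0 < cmod z" "cmod z < 1"
  shows "real n \<le> (Re (S_minus_enum z n))\<^sup>2 + cmod (Ln z)"
proof -
  let ?\<xi> = "S_minus_enum z n"
  have \<xi>: "?\<xi> \<in> S_minus z"
    using bij_betw_S_minus_enum[OF assms] by (auto simp: bij_betw_def)
  have "ln (cmod z) < 0" using assms by simp
  then have Im: "(Im ?\<xi>)\<^sup>2 \<le> (Re ?\<xi>)\<^sup>2"
    using S_minus_real_parts(2)[OF \<xi>] by simp
  have "4 * of_real pi * \<i> * of_int (int_decode n) = - 2 * Ln z - ?\<xi>\<^sup>2"
    by (simp add: S_minus_enum_square)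
  then have "cmod (4 * of_real pi * \<i> * of_int (int_decode n)) \<le> cmod (- 2 * Ln z) + cmod (?\<xi>\<^sup>2)"
    using norm_triangle_ineq4 by metis
  then have "4 * pi * \<bar>of_int (int_decode n)\<bar> \<le> 2 * cmod (Ln z) + (cmod ?\<xi>)\<^sup>2"
    by (simp add: norm_mult norm_power)
  also have "(cmod ?\<xi>)\<^sup>2 \<le> 2 * (Re ?\<xi>)\<^sup>2"
    using Im by (simp add: cmod_power2)
  finally have *: "2 * pi * \<bar>of_int (int_decode n)\<bar> \<le> cmod (Ln z) + (Re ?\<xi>)\<^sup>2"
    by simp
  have "real n \<le> 2 * \<bar>of_int (int_decode n)\<bar>"
    using of_int_le_iff[where 'a = real, THEN iffD2, OF le_abs_int_decode[of n]] by simp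
  also have "\<dots> \<le> 2 * pi * \<bar>of_int (int_decode n)\<bar>"
    using pi_gt3 by (intro mult_right_mono) auto
  finally show ?thesis
    using * by simp
qed

section \<open>Bounds for Q and for the weights\<close>

lemma cmod_polylog_half_le:
  assumes "cmod w < 1"
  shows "cmod (polylog (1 / 2) w) \<le> cmod w / (1 - cmod w)"
proof -
  have le: "cmod (w ^ Suc k / of_nat (Suc k) powr (1 / 2)) \<le> cmod w * cmod w ^ k" for k
  proof -
    \<comment> \<open>The coefficients 1/sqrt(k + 1) are at most 1, so the geometric series
      dominates.\<close>
    have "1 \<le> real (Suc k) powr (1 / 2)"
      by (rule ge_one_powr_ge_zero) auto
    then have "1 \<le> cmod (of_nat (Suc k) powr (1 / 2))"
      by (simp add: norm_powr_real_powr del: of_nat_Suc)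
    then have "cmod (w ^ Suc k) / cmod (of_nat (Suc k) powr (1 / 2)) \<le> cmod (w ^ Suc k) / 1"
      by (intro frac_le) auto
    then show ?thesis
      by (simp add: norm_divide norm_mult norm_power del: of_nat_Suc)
  qed
  have "cmod (polylog (1 / 2) w) \<le> (\<Sum>k. cmod w * cmod w ^ k)"
    unfolding polylog_def using assms by (intro norm_suminf_le le summable_mult summable_geometric) simp
  also have "\<dots> = cmod w / (1 - cmod w)"
    using assms by (simp add: suminf_mult summable_geometric suminf_geometric)
  finally show ?thesis .
qed

text \<open>For f not integrable the integral is 0 by convention, and g is nonnegative as a bound of
  moduli. Thus Q can be estimated from a pointwise bound on its integrand alone.\<close>

lemma norm_integral_le_of_bound:
  fixes f :: "'a \<Rightarrow> complex"
  assumes g: "integrable M g" and le: "\<And>x. x \<in> space M \<Longrightarrow> cmod (f x) \<le> g x"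
  shows "cmod (LINT x|M. f x) \<le> (LINT x|M. g x)"
proof (cases "integrable M f")
  case True
  show ?thesis
    by (rule order_trans[OF integral_norm_bound]) (intro integral_mono integrable_norm True g le)
next
  case False
  have "0 \<le> (LINT x|M. g x)"
    using order_trans[OF norm_ge_zero le] by (intro Bochner_Integration.integral_nonneg) auto
  then show ?thesis
    using False by (simp add: not_integrable_integral_eq)
qed

lemma integrable_exp_nonpos:
  fixes c :: real
  assumes "0 < c"
  shows "integrable lborel (\<lambda>t. indicator {..0} t * exp (c * t))"
proof -
  have "integrable lborel (\<lambda>t. indicator {0<..} t * exp (- c * t))"
    using exp_real_half_line[OF assms]
    by (simp add: half_line_def integrable_restrict_space)
  then have "integrable lborel (\<lambda>t. indicator {0<..} (0 + (- 1) * t) * exp (- c * (0 + (- 1) * t)))"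
    by (subst lborel_integrable_real_affine_iff) auto
  also have "?this \<longleftrightarrow> ?thesis"
  proof (rule integrable_cong_AE)
    \<comment> \<open>Reflection gives the open half line t < 0; the endpoint 0 is a null
      set.\<close>
    show "AE t in lborel. indicator {0<..} (0 + (- 1) * t) * exp (- c * (0 + (- 1) * t)) =
        indicator {..0} t * exp (c * t)"
      using AE_lborel_singleton[of "0::real"] by eventually_elim (auto simp: indicator_def)
  qed measurable
  finally show ?thesis .
qed

text \<open>For t \<le> 0, passing from \<xi> to \<xi> + t adds 2 t Re \<xi> + t^2 \<ge> -2 \<delta>
  t to the real part of the square. So the argument of the polylogarithm has modulus at most |z|
  exp(\<delta> t), which is integrable in t and uniform in \<xi>.\<close>

lemma Q_fun_bounded_on_S_minus:
  assumes "0 < cmod z" "cmod z < 1"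
  obtains C where "\<And>\<xi>. \<xi> \<in> S_minus z \<Longrightarrow> cmod (Q_fun \<xi>) \<le> C"
proof
  define \<delta> where "\<delta> = sqrt (- 2 * ln (cmod z))"
  have \<delta>: "0 < \<delta>" using assms by (simp add: \<delta>_def)
  define q where "q = cmod z"
  have q: "0 < q" "q < 1" using assms by (simp_all add: q_def)
  let ?g = "\<lambda>t. q / (1 - q) * (indicator {..0} t * exp (\<delta> * t))"
  fix \<xi> assume \<xi>: "\<xi> \<in> S_minus z"
  have "cmod (polylog (1 / 2) (exp (- (\<xi> + complex_of_real t)\<^sup>2 / 2))) \<le> q / (1 - q) * exp (\<delta> * t)"
    if "t \<le> 0" for t
  proof -
    let ?w = "exp (- (\<xi> + complex_of_real t)\<^sup>2 / 2)"
    have "\<delta> * t \<ge> - t * Re \<xi>"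
      using mult_left_mono_neg[OF Re_le_S_minus[OF \<xi>] that] by (simp add: \<delta>_def mult.commute)
    moreover have sq: "(Re \<xi> + t)\<^sup>2 = (Re \<xi>)\<^sup>2 + 2 * (t * Re \<xi>) + t\<^sup>2"
      by (simp add: power2_sum)
    ultimately have "- ((Re \<xi> + t)\<^sup>2 - (Im \<xi>)\<^sup>2) / 2 \<le> ln q + \<delta> * t"
      using S_minus_real_parts(2)[OF \<xi>] zero_le_power2[of t] sq unfolding q_def by argo
    then have "cmod ?w \<le> exp (ln q + \<delta> * t)"
      by (simp add: Re_power2 field_simps)
    then have w: "cmod ?w \<le> q * exp (\<delta> * t)"
      using q by (simp add: exp_add)
    have "exp (\<delta> * t) \<le> 1"
      using \<delta> that by (simp add: mult_nonneg_nonpos)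
    then have w': "cmod ?w \<le> q"
      using w q by (meson order_trans mult_left_le less_imp_le)
    have "cmod (polylog (1 / 2) ?w) \<le> cmod ?w / (1 - cmod ?w)"
      by (rule cmod_polylog_half_le[OF le_less_trans[OF w' q(2)]])
    also have "\<dots> \<le> q * exp (\<delta> * t) / (1 - q)"
      using w w' q by (intro frac_le) auto
    finally show ?thesis by simp
  qed
  then have "cmod (LINT t:{..0::real}|lborel. polylog (1 / 2) (exp (- (\<xi> + complex_of_real t)\<^sup>2 / 2))) \<le>
      (LINT t|lborel. ?g t)"
    unfolding set_lebesgue_integral_def
    by (intro norm_integral_le_of_bound integrable_mult_right integrable_exp_nonpos \<delta>)
      (auto simp: indicator_def)
  then show "cmod (Q_fun \<xi>) \<le> sqrt (2 / pi) * (LINT t|lborel. ?g t)"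
    unfolding Q_fun_def norm_mult by (intro mult_mono) auto
qed

lemma cubic_bounded_above:
  fixes c p d :: real
  assumes c: "0 < c" and p: "0 \<le> p" and d: "0 \<le> d"
  obtains B where "\<And>a. 0 \<le> a \<Longrightarrow> - c * a ^ 3 + p * a\<^sup>2 + d * a \<le> B"
proof
  \<comment> \<open>Beyond R both a \<ge> 1 and c a \<ge> p + d hold, so the cubic term outweighs
    the other two and the polynomial is at most 0.\<close>
  define R where "R = 1 + (p + d) / c"
  have R: "1 \<le> R" using assms by (simp add: R_def)
  fix a :: real assume a: "0 \<le> a"
  show "- c * a ^ 3 + p * a\<^sup>2 + d * a \<le> p * R\<^sup>2 + d * R"
  proof (cases "a \<le> R")
    case True
    then have "p * a\<^sup>2 \<le> p * R\<^sup>2" "d * a \<le> d * R" "0 \<le> c * a ^ 3"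
      using a c p d by (auto intro!: mult_left_mono power_mono)
    then show ?thesis by simp
  next
    case False
    then have "1 \<le> a" using R by simp
    then have "d * a \<le> d * a\<^sup>2"
      using d by (intro mult_left_mono) (auto simp: power2_eq_square)
    moreover have "p + d \<le> c * a"
      using False c by (simp add: R_def field_simps)
    then have "(p + d) * a\<^sup>2 \<le> c * a * a\<^sup>2"
      by (intro mult_right_mono) auto
    moreover have "0 \<le> p * R\<^sup>2 + d * R"
      using R p d by simp
    ultimately show ?thesis
      by (simp add: power2_eq_square power3_eq_cube algebra_simps)
  qed
qed

text \<open>With a = -Re \<xi>, the hyperbola gives Re(\<xi>^3) = 2 a^3 - 3 m a, so the exponent is
  a cubic in a with leading coefficient -2\<tau>/3, up to bounded terms from Q and \<gamma>.\<close>

lemma weight_S_minus_le: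
  assumes \<tau>: "0 < \<tau>" and z: "0 < cmod z" "cmod z < 1"
  obtains C where "\<And>k. cmod (exp (Phi \<tau> x (S_minus_enum z k)
      + complex_of_real \<gamma> / 2 * (S_minus_enum z k)\<^sup>2) / (- S_minus_enum z k)) \<le> C / 4 ^ k"
proof -
  define m where "m = - 2 * ln (cmod z)"
  have m: "0 < m" using z by (simp add: m_def)
  obtain CQ where CQ: "\<And>\<xi>. \<xi> \<in> S_minus z \<Longrightarrow> cmod (Q_fun \<xi>) \<le> CQ"
    using Q_fun_bounded_on_S_minus[OF z] by blast
  \<comment> \<open>The summand ln 4 a^2 is the decay to be extracted: moved to the other side it
    becomes the factor 4^(-a^2).\<close>
  obtain B where B: "\<And>a. 0 \<le> a \<Longrightarrow> - (2 * \<tau> / 3) * a ^ 3 + ln 4 * a\<^sup>2 + (\<tau> * m + \<bar>x\<bar>) * a \<le> B"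
    using cubic_bounded_above[of "2 * \<tau> / 3" "ln 4" "\<tau> * m + \<bar>x\<bar>"] \<tau> m by auto
  \<comment> \<open>The last summand compensates the shift in k \<le> a^2 + |Ln z|.\<close>
  define E where "E = B + CQ + \<gamma> / 2 * m + ln 4 * cmod (Ln z)"
  show ?thesis
  proof (rule that)
    fix k
    define \<xi> where "\<xi> = S_minus_enum z k"
    have \<xi>: "\<xi> \<in> S_minus z"
      using bij_betw_S_minus_enum[OF z] by (auto simp: bij_betw_def \<xi>_def)
    define a where "a = - Re \<xi>"
    have a: "sqrt m \<le> a" "0 < a" and b: "(Im \<xi>)\<^sup>2 = a\<^sup>2 - m"
      using Re_le_S_minus[OF \<xi>] S_minus_real_parts[OF \<xi>] by (auto simp: a_def m_def)
    have Re3: "Re (\<xi> ^ 3) = 2 * a ^ 3 - 3 * m * a"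
    proof -
      have "Re (\<xi> ^ 3) = (Re \<xi>) ^ 3 - 3 * Re \<xi> * (Im \<xi>)\<^sup>2"
        by (simp add: power3_eq_cube power2_eq_square algebra_simps)
      then show ?thesis
        unfolding b a_def by (simp add: power3_eq_cube power2_eq_square algebra_simps)
    qed
    have Re2: "Re (\<xi>\<^sup>2) = m"
      using b by (simp add: Re_power2 a_def)
    have "Re (Phi \<tau> x \<xi> + complex_of_real \<gamma> / 2 * \<xi>\<^sup>2) =
        - (\<tau> / 3) * (2 * a ^ 3 - 3 * m * a) - x * a - Re (Q_fun \<xi>) + \<gamma> / 2 * m"
      using Re3 Re2 by (simp add: Phi_def a_def)
    also have "\<dots> \<le> - (2 * \<tau> / 3) * a ^ 3 + (\<tau> * m + \<bar>x\<bar>) * a + CQ + \<gamma> / 2 * m"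
    proof -
      have "- Re (Q_fun \<xi>) \<le> CQ"
        using CQ[OF \<xi>] abs_Re_le_cmod[of "Q_fun \<xi>"] by simp
      moreover have "- x * a \<le> \<bar>x\<bar> * a"
        using a by (intro mult_right_mono) auto
      ultimately show ?thesis by (simp add: algebra_simps)
    qed
    also have "\<dots> \<le> E - ln 4 * (a\<^sup>2 + cmod (Ln z))"
      using B[of a] a by (simp add: E_def algebra_simps)
    also have "\<dots> \<le> E - ln 4 * real k"
      using index_le_S_minus_enum[OF z, of k] by (simp add: a_def \<xi>_def)
    finally have "cmod (exp (Phi \<tau> x \<xi> + complex_of_real \<gamma> / 2 * \<xi>\<^sup>2)) \<le> exp (E - ln 4 * real k)"
      by simp
    also have "\<dots> = exp E / 4 ^ k"
      by (simp add: exp_diff exp_of_nat2_mult)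
    finally have "cmod (exp (Phi \<tau> x \<xi> + complex_of_real \<gamma> / 2 * \<xi>\<^sup>2)) / cmod (- \<xi>) \<le> (exp E / 4 ^ k) / sqrt m"
      using a m abs_Re_le_cmod[of \<xi>] by (intro frac_le) (auto simp: a_def)
    then show "cmod (exp (Phi \<tau> x (S_minus_enum z k) + complex_of_real \<gamma> / 2 * (S_minus_enum z k)\<^sup>2)
        / (- S_minus_enum z k)) \<le> (exp E / sqrt m) / 4 ^ k"
      by (simp add: \<xi>_def norm_divide mult.commute)
  qed
qed

theorem lemma1p1:
  fixes \<tau> \<gamma> x :: real and z :: complex
  assumes "\<tau> > 0" and "0 < cmod z" and "cmod z < 1"
  shows "trace_class_kernel half_line (T_ker \<tau> \<gamma> x z) \<and>
    (\<exists>D. has_fredholm_det (count_space (S_minus z)) (K_ker \<tau> \<gamma> x z) D \<and>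
         has_fredholm_det half_line
           (kernel_comp half_line (T_ker \<tau> (- \<gamma>) x z) (T_ker \<tau> \<gamma> x z)) D)"
proof -
  \<comment> \<open>In the exponent of K each outer point carries \<gamma>/4, so p^2 has the
    \<gamma>/2 of the operator for \<gamma>; the inner point carries -\<gamma>/2, the weight for
    -\<gamma>.\<close>
  define p where "p \<xi> = exp (Phi \<tau> x \<xi> / 2 + complex_of_real \<gamma> / 4 * \<xi>\<^sup>2) / csqrt (- \<xi>)" for \<xi>
  define v where "v \<eta> = exp (Phi \<tau> x \<eta> + complex_of_real (- \<gamma>) / 2 * \<eta>\<^sup>2) / (- \<eta>)" for \<eta>
  have p2: "(p \<xi>)\<^sup>2 = exp (Phi \<tau> x \<xi> + complex_of_real \<gamma> / 2 * \<xi>\<^sup>2) / (- \<xi>)" for \<xi>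
    by (simp add: p_def power_divide exp_double[symmetric] algebra_simps)
  obtain C1 where C1: "\<And>k. cmod ((p (S_minus_enum z k))\<^sup>2) \<le> C1 / 4 ^ k"
    unfolding p2 using weight_S_minus_le[OF assms] by metis
  obtain C2 where C2: "\<And>k. cmod (v (S_minus_enum z k)) \<le> C2 / 4 ^ k"
    unfolding v_def using weight_S_minus_le[OF assms] by metis
  have C: "C1 / 4 ^ k \<le> max C1 C2 / 4 ^ k" "C2 / 4 ^ k \<le> max C1 C2 / 4 ^ k" for k :: nat
    by (auto intro: divide_right_mono)
  \<comment> \<open>The shift by x is absorbed into \<open>Phi\<close>, leaving an exponential in s
    + t.\<close>
  have T: "T_ker \<tau> g x z s t = (\<Sum>\<^sub>\<infinity>\<xi>\<in>S_minus z.
      exp (Phi \<tau> x \<xi> + complex_of_real g / 2 * \<xi>\<^sup>2) / (- \<xi>) * exp (complex_of_real (s + t) * \<xi>))" for g s t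
    unfolding T_ker_def T_fun_def Phi_def
    by (intro infsum_cong) (simp add: mult_exp_exp algebra_simps)
  have K: "K_ker \<tau> \<gamma> x z \<xi> \<xi>' = (\<Sum>\<^sub>\<infinity>\<eta>\<in>S_minus z. p \<xi> * v \<eta> * p \<xi>' / ((\<xi> + \<eta>) * (\<eta> + \<xi>')))" for \<xi> \<xi>'
  proof -
    have "exp (Phi \<tau> x \<xi> / 2 + Phi \<tau> x \<eta> + Phi \<tau> x \<xi>' / 2 + complex_of_real \<gamma> / 4 * (\<xi>\<^sup>2 - 2 * \<eta>\<^sup>2 + \<xi>'\<^sup>2)) =
        exp (Phi \<tau> x \<xi> / 2 + complex_of_real \<gamma> / 4 * \<xi>\<^sup>2) *
        exp (Phi \<tau> x \<eta> + complex_of_real (- \<gamma>) / 2 * \<eta>\<^sup>2) *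
        exp (Phi \<tau> x \<xi>' / 2 + complex_of_real \<gamma> / 4 * \<xi>'\<^sup>2)" for \<eta>
      unfolding mult_exp_exp by (intro arg_cong[of _ _ exp]) (simp add: algebra_simps)
    then show ?thesis
      unfolding K_ker_def p_def v_def by (intro infsum_cong) (simp add: mult_ac)
  qed
  have \<delta>: "0 < sqrt (- 2 * ln (cmod z))"
    using assms by simp
  have p_le: "(cmod (p (S_minus_enum z k)))\<^sup>2 \<le> max C1 C2 / 4 ^ k" for k
    using order_trans[OF C1 C(1)] by (simp add: norm_power)
  have v_le: "cmod (v (S_minus_enum z k)) \<le> max C1 C2 / 4 ^ k" for k
    by (rule order_trans[OF C2 C(2)])
  have Ku: "T_ker \<tau> \<gamma> x z s t = (\<Sum>\<^sub>\<infinity>\<xi>\<in>S_minus z. (p \<xi>)\<^sup>2 * exp (complex_of_real (s + t) * \<xi>))" for s t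
    unfolding T p2 ..
  have Kv: "T_ker \<tau> (- \<gamma>) x z s t = (\<Sum>\<^sub>\<infinity>\<xi>\<in>S_minus z. v \<xi> * exp (complex_of_real (s + t) * \<xi>))" for s t
    unfolding T v_def ..
  show ?thesis
    using fredholm_det_exp_sums[OF bij_betw_S_minus_enum[OF assms(2,3)] \<delta> Re_le_S_minus p_le v_le Ku Kv K]
    by simp
qed

end
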